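(* Let $X$ be a complex Banach space and let $A\subseteq B(X)$ be an abelian, unital, norm closed algebra of split strict multiplicity $p$, realized by vectors $x_1,\dots,x_p\in X$. Then there exist closed ideals $I_k\subseteq A$, $k=1,\dots,p$, and Banach space isomorphisms $S_k:A/I_k\to Ax_k$ such that, with $\varphi_k:A\to A/I_k$ the quotient map: (i) $S_k(\varphi_k(a))=ax_k$ for all $a\in A$ and $k=1,\dots,p$. (ii) $S=\bigoplus_{k=1}^p S_k:\bigoplus_{k=1}^p A/I_k\to X$, that is $S(\varphi_1(a_1)\oplus\cdots\oplus\varphi_p(a_p))=\sum_{k=1}^pS_k(\varphi_k(a_k))$, is a Banach space isomorphism. (iii) The mapping $A\to B\big(\bigoplus_{k=1}^p A/I_k\big)$, $a\mapsto S^{-1}aS$, is a Banach algebra isomorphism onto its image. (iv) If $p=2$, then $I_1+I_2$ is closed.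
   Context: $B(X)$ is the algebra of bounded linear operators on $X$; $A$ carries the operator norm. An algebra $A\subset B(X)$ has split strict multiplicity $p\in\mathbb{N}$, written $s.s.m.(A)=p$, if there are $x_1,\dots,x_p\in X$ such that the subspaces $X_i=Ax_i=\{ax_i : a\in A\}$ are closed and $X=X_1\oplus\cdots\oplus X_p$ (such vectors are fixed; they "realize" the split strict multiplicity). Isomorphisms of Banach spaces or Banach algebras are topological (bounded with bounded inverse), not necessarily isometric. The finite direct sum $\bigoplus_k A/I_k$ carries any of the usual equivalent norms, e.g. the sum of the quotient norms. *)

theory Defs
  imports "HOL-Analysis.Analysis" "HOL-Library.Set_Algebras" "HOL-Library.FuncSet"
begin

class complex_normed_vector = real_normed_vector +
  fixes scaleC :: "complex \<Rightarrow> 'a \<Rightarrow> 'a"  (infixr "*\<^sub>C" 75)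
  assumes scaleC_add_right: "c *\<^sub>C (x + y) = c *\<^sub>C x + c *\<^sub>C y"
    and scaleC_add_left: "(c + d) *\<^sub>C x = c *\<^sub>C x + d *\<^sub>C x"
    and scaleC_scaleC: "c *\<^sub>C d *\<^sub>C x = (c * d) *\<^sub>C x"
    and scaleR_scaleC: "r *\<^sub>R x = complex_of_real r *\<^sub>C x"
    and norm_scaleC: "norm (c *\<^sub>C x) = cmod c * norm x"

class complex_banach = complex_normed_vector + banach

instantiation complex :: complex_banach
begin
definition scaleC_complex :: "complex \<Rightarrow> complex \<Rightarrow> complex"
  where "scaleC_complex c x = c * x"
instance
  by standard (auto simp: scaleC_complex_def algebra_simps norm_mult scaleR_conv_of_real)
end

lemma bounded_linear_scaleC: "bounded_linear (\<lambda>x::'a::complex_normed_vector. c *\<^sub>C x)"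
proof (rule bounded_linear_intro[where K = "cmod c"])
  fix r and x :: 'a
  show "c *\<^sub>C r *\<^sub>R x = r *\<^sub>R c *\<^sub>C x"
    by (simp add: scaleR_scaleC scaleC_scaleC mult.commute)
qed (simp_all add: scaleC_add_right norm_scaleC mult.commute)

text \<open>
  The type \<open>'a \<Rightarrow>\<^sub>L 'b\<close> of bounded \<^emph>\<open>real\<close>-linear maps with the operator norm is a complex
  normed space under pointwise multiplication by complex scalars; the complex-linear
  maps form a subspace of it, see \<open>clinear_operators\<close> below.
\<close>

instantiation blinfun :: (real_normed_vector, complex_normed_vector) complex_normed_vector
begin
lift_definition scaleC_blinfun :: "complex \<Rightarrow> 'a \<Rightarrow>\<^sub>L 'b \<Rightarrow> 'a \<Rightarrow>\<^sub>L 'b" is "\<lambda>c f x. c *\<^sub>C f x"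
  by (rule bounded_linear_compose[OF bounded_linear_scaleC])
instance
proof
  fix c d :: complex and r :: real and f g :: "'a \<Rightarrow>\<^sub>L 'b"
  show "c *\<^sub>C (f + g) = c *\<^sub>C f + c *\<^sub>C g" by transfer (simp add: scaleC_add_right)
  show "(c + d) *\<^sub>C f = c *\<^sub>C f + d *\<^sub>C f" by transfer (simp add: scaleC_add_left)
  show "c *\<^sub>C d *\<^sub>C f = (c * d) *\<^sub>C f" by transfer (simp add: scaleC_scaleC)
  show "r *\<^sub>R f = complex_of_real r *\<^sub>C f" by transfer (simp add: scaleR_scaleC)
  have le: "norm (b *\<^sub>C h) \<le> cmod b * norm h" for b and h :: "'a \<Rightarrow>\<^sub>L 'b"
  proof (rule norm_blinfun_bound)
    fix x
    show "norm (blinfun_apply (b *\<^sub>C h) x) \<le> cmod b * norm h * norm x"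
      by (simp add: scaleC_blinfun.rep_eq norm_scaleC mult.assoc mult_left_mono norm_blinfun)
  qed simp
  show "norm (c *\<^sub>C f) = cmod c * norm f"
  proof (cases "c = 0")
    case True
    then show ?thesis using le[of 0 f] by simp
  next
    case False
    have "blinfun_apply (inverse c *\<^sub>C c *\<^sub>C f) x = blinfun_apply f x" for x
      using False scaleR_scaleC[of 1 "blinfun_apply f x"]
      by (simp add: scaleC_blinfun.rep_eq scaleC_scaleC)
    then have "norm f = norm (inverse c *\<^sub>C c *\<^sub>C f)"
      by (metis blinfun_eqI)
    also have "\<dots> \<le> inverse (cmod c) * norm (c *\<^sub>C f)"
      using le[of "inverse c" "c *\<^sub>C f"] by (simp add: norm_inverse)
    finally have "cmod c * norm f \<le> norm (c *\<^sub>C f)"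
      using False by (simp add: field_simps)
    with le[of c f] show ?thesis by linarith
  qed
qed
end

instance blinfun :: (real_normed_vector, complex_banach) complex_banach ..

definition csubspace :: "'a::complex_normed_vector set \<Rightarrow> bool"
  where "csubspace V \<longleftrightarrow>
    0 \<in> V \<and> (\<forall>x\<in>V. \<forall>y\<in>V. x + y \<in> V) \<and> (\<forall>c. \<forall>x\<in>V. c *\<^sub>C x \<in> V)"

text \<open>The underlying set of the algebra $B(X)$.\<close>

definition clinear_operators :: "('x::complex_normed_vector \<Rightarrow>\<^sub>L 'x) set"
  where "clinear_operators =
    {f. \<forall>c x. blinfun_apply f (c *\<^sub>C x) = c *\<^sub>C blinfun_apply f x}"

text \<open>
  Quotients \<open>A / I\<close>, direct sums of these, and the algebra of bounded operators on such a
  direct sum depend on sets \<open>A\<close> and \<open>I\<close>, so they cannot be types and are given as records.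
\<close>

record 'b normed_struct =
  carrier :: "'b set"
  vadd :: "'b \<Rightarrow> 'b \<Rightarrow> 'b"
  vzero :: 'b
  vscale :: "complex \<Rightarrow> 'b \<Rightarrow> 'b"
  vnorm :: "'b \<Rightarrow> real"

record 'b algebra_struct = "'b normed_struct" +
  amult :: "'b \<Rightarrow> 'b \<Rightarrow> 'b"
  aone :: 'b

locale normed_space_on =
  fixes V :: "('b, 'm) normed_struct_scheme"
  assumes add_closed: "\<lbrakk>x \<in> carrier V; y \<in> carrier V\<rbrakk> \<Longrightarrow> vadd V x y \<in> carrier V"
    and zero_closed: "vzero V \<in> carrier V"
    and scale_closed: "x \<in> carrier V \<Longrightarrow> vscale V c x \<in> carrier V"
    and add_assoc: "\<lbrakk>x \<in> carrier V; y \<in> carrier V; z \<in> carrier V\<rbrakk>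
      \<Longrightarrow> vadd V (vadd V x y) z = vadd V x (vadd V y z)"
    and add_commute: "\<lbrakk>x \<in> carrier V; y \<in> carrier V\<rbrakk> \<Longrightarrow> vadd V x y = vadd V y x"
    and add_zero: "x \<in> carrier V \<Longrightarrow> vadd V x (vzero V) = x"
    and add_inverse: "x \<in> carrier V \<Longrightarrow> \<exists>y\<in>carrier V. vadd V x y = vzero V"
    and scale_add_right: "\<lbrakk>x \<in> carrier V; y \<in> carrier V\<rbrakk>
      \<Longrightarrow> vscale V c (vadd V x y) = vadd V (vscale V c x) (vscale V c y)"
    and scale_add_left: "x \<in> carrier V
      \<Longrightarrow> vscale V (c + d) x = vadd V (vscale V c x) (vscale V d x)"
    and scale_scale: "x \<in> carrier V \<Longrightarrow> vscale V c (vscale V d x) = vscale V (c * d) x"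
    and scale_one: "x \<in> carrier V \<Longrightarrow> vscale V 1 x = x"
    and norm_nonneg: "x \<in> carrier V \<Longrightarrow> 0 \<le> vnorm V x"
    and norm_eq_zero: "x \<in> carrier V \<Longrightarrow> vnorm V x = 0 \<longleftrightarrow> x = vzero V"
    and norm_scale: "x \<in> carrier V \<Longrightarrow> vnorm V (vscale V c x) = cmod c * vnorm V x"
    and norm_triangle: "\<lbrakk>x \<in> carrier V; y \<in> carrier V\<rbrakk>
      \<Longrightarrow> vnorm V (vadd V x y) \<le> vnorm V x + vnorm V y"

text \<open>
  The library locale \<open>Metric_space\<close> demands nonnegativity and symmetry of the distance on the
  whole type, hence the value \<open>0\<close> outside the carrier.
\<close>

definition vdist :: "('b, 'm) normed_struct_scheme \<Rightarrow> 'b \<Rightarrow> 'b \<Rightarrow> real"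
  where "vdist V x y =
    (if x \<in> carrier V \<and> y \<in> carrier V then vnorm V (vadd V x (vscale V (- 1) y)) else 0)"

lemma (in normed_space_on) Metric_space_vdist: "Metric_space (carrier V) (vdist V)"
proof
  note cl = add_closed scale_closed zero_closed
  have scale_zero: "vscale V 0 x = vzero V" if x: "x \<in> carrier V" for x
    using norm_scale[OF x, of 0] norm_eq_zero[OF scale_closed[OF x]] by simp
  have neg: "vadd V x (vscale V (- 1) x) = vzero V" if x: "x \<in> carrier V" for x
    using scale_add_left[OF x, of 1 "- 1"] scale_one[OF x] scale_zero[OF x] by simp
  have cancel: "vadd V (vadd V x (vscale V (- 1) y)) (vadd V y z) = vadd V x z"
    if x: "x \<in> carrier V" and y: "y \<in> carrier V" and z: "z \<in> carrier V" for x y z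
  proof -
    have "vadd V (vadd V x (vscale V (- 1) y)) (vadd V y z)
        = vadd V x (vadd V (vadd V (vscale V (- 1) y) y) z)"
      using x y z by (simp add: add_assoc cl)
    also have "\<dots> = vadd V x z"
      using x y z by (simp add: add_commute[of "vscale V (- 1) y" y] neg cl
          add_commute[of "vzero V" z] add_zero)
    finally show ?thesis .
  qed
  fix x y z
  show "0 \<le> vdist V x y"
    by (simp add: vdist_def norm_nonneg cl)
  show "vdist V x y = vdist V y x"
  proof (cases "x \<in> carrier V \<and> y \<in> carrier V")
    case True
    then have "vadd V y (vscale V (- 1) x) = vscale V (- 1) (vadd V x (vscale V (- 1) y))"
      by (simp add: scale_add_right scale_scale scale_one cl add_commute)
    with True show ?thesis
      by (simp add: vdist_def norm_scale cl)
  qed (auto simp: vdist_def)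
  assume x: "x \<in> carrier V" and y: "y \<in> carrier V"
  show "vdist V x y = 0 \<longleftrightarrow> x = y"
  proof
    assume "vdist V x y = 0"
    then have z: "vadd V x (vscale V (- 1) y) = vzero V"
      using x y by (simp add: vdist_def norm_eq_zero cl)
    have "x = vadd V x (vzero V)" using x by (simp add: add_zero)
    also have "\<dots> = vadd V (vadd V x (vscale V (- 1) y)) (vadd V y (vzero V))"
      using cancel[OF x y zero_closed] by simp
    also have "\<dots> = y" using y by (simp add: z add_zero add_commute[of _ y] cl)
    finally show "x = y" .
  qed (use x in \<open>simp add: vdist_def neg norm_eq_zero zero_closed\<close>)
  assume z: "z \<in> carrier V"
  have "vadd V x (vscale V (- 1) z) =
      vadd V (vadd V x (vscale V (- 1) y)) (vadd V y (vscale V (- 1) z))"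
    using cancel[OF x y, of "vscale V (- 1) z"] z by (simp add: cl)
  then show "vdist V x z \<le> vdist V x y + vdist V y z"
    using x y z by (simp add: vdist_def norm_triangle cl)
qed

locale banach_space_on = normed_space_on V for V :: "('b, 'm) normed_struct_scheme" +
  assumes complete: "Metric_space.mcomplete (carrier V) (vdist V)"

locale banach_algebra_on = banach_space_on M for M :: "('b, 'm) algebra_struct_scheme" +
  assumes mult_closed: "\<lbrakk>x \<in> carrier M; y \<in> carrier M\<rbrakk> \<Longrightarrow> amult M x y \<in> carrier M"
    and one_closed: "aone M \<in> carrier M"
    and mult_assoc: "\<lbrakk>x \<in> carrier M; y \<in> carrier M; z \<in> carrier M\<rbrakk>
      \<Longrightarrow> amult M (amult M x y) z = amult M x (amult M y z)"
    and mult_one_left: "x \<in> carrier M \<Longrightarrow> amult M (aone M) x = x"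
    and mult_one_right: "x \<in> carrier M \<Longrightarrow> amult M x (aone M) = x"
    and mult_add_left: "\<lbrakk>x \<in> carrier M; y \<in> carrier M; z \<in> carrier M\<rbrakk>
      \<Longrightarrow> amult M (vadd M x y) z = vadd M (amult M x z) (amult M y z)"
    and mult_add_right: "\<lbrakk>x \<in> carrier M; y \<in> carrier M; z \<in> carrier M\<rbrakk>
      \<Longrightarrow> amult M x (vadd M y z) = vadd M (amult M x y) (amult M x z)"
    and mult_scale_left: "\<lbrakk>x \<in> carrier M; y \<in> carrier M\<rbrakk>
      \<Longrightarrow> amult M (vscale M c x) y = vscale M c (amult M x y)"
    and mult_scale_right: "\<lbrakk>x \<in> carrier M; y \<in> carrier M\<rbrakk>
      \<Longrightarrow> amult M x (vscale M c y) = vscale M c (amult M x y)"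
    and norm_mult_le: "\<lbrakk>x \<in> carrier M; y \<in> carrier M\<rbrakk>
      \<Longrightarrow> vnorm M (amult M x y) \<le> vnorm M x * vnorm M y"

definition bounded_clinear_on ::
  "('b, 'm) normed_struct_scheme \<Rightarrow> ('c, 'n) normed_struct_scheme \<Rightarrow> ('b \<Rightarrow> 'c) \<Rightarrow> bool"
  where "bounded_clinear_on V W f \<longleftrightarrow>
    f \<in> carrier V \<rightarrow> carrier W \<and>
    (\<forall>x\<in>carrier V. \<forall>y\<in>carrier V. f (vadd V x y) = vadd W (f x) (f y)) \<and>
    (\<forall>c. \<forall>x\<in>carrier V. f (vscale V c x) = vscale W c (f x)) \<and>
    (\<exists>C. \<forall>x\<in>carrier V. vnorm W (f x) \<le> C * vnorm V x)"

definition banach_space_iso ::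
  "('b, 'm) normed_struct_scheme \<Rightarrow> ('c, 'n) normed_struct_scheme \<Rightarrow> ('b \<Rightarrow> 'c) \<Rightarrow> bool"
  where "banach_space_iso V W f \<longleftrightarrow>
    banach_space_on V \<and> banach_space_on W \<and>
    bij_betw f (carrier V) (carrier W) \<and>
    bounded_clinear_on V W f \<and>
    bounded_clinear_on W V (inv_into (carrier V) f)"

definition banach_algebra_iso ::
  "('b, 'm) algebra_struct_scheme \<Rightarrow> ('c, 'n) algebra_struct_scheme \<Rightarrow> ('b \<Rightarrow> 'c) \<Rightarrow> bool"
  where "banach_algebra_iso M N f \<longleftrightarrow>
    banach_algebra_on M \<and> banach_algebra_on N \<and>
    banach_space_iso M N f \<and>
    (\<forall>x\<in>carrier M. \<forall>y\<in>carrier M. f (amult M x y) = amult N (f x) (f y)) \<and>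
    f (aone M) = aone N"

definition banach_algebra_iso_onto_image ::
  "('b, 'm) algebra_struct_scheme \<Rightarrow> ('c, 'n) algebra_struct_scheme \<Rightarrow> ('b \<Rightarrow> 'c) \<Rightarrow> bool"
  where "banach_algebra_iso_onto_image M N f \<longleftrightarrow>
    f ` carrier M \<subseteq> carrier N \<and> banach_algebra_iso M (N\<lparr>carrier := f ` carrier M\<rparr>) f"

definition subspace_struct :: "'a::complex_normed_vector set \<Rightarrow> 'a normed_struct"
  where "subspace_struct V =
    \<lparr>carrier = V, vadd = (+), vzero = 0, vscale = scaleC, vnorm = norm\<rparr>"

definition operator_algebra ::
  "('x::complex_normed_vector \<Rightarrow>\<^sub>L 'x) set \<Rightarrow> ('x \<Rightarrow>\<^sub>L 'x) algebra_struct"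
  where "operator_algebra A =
    \<lparr>carrier = A, vadd = (+), vzero = 0, vscale = scaleC, vnorm = norm,
     amult = (o\<^sub>L), aone = id_blinfun\<rparr>"

text \<open>
  \<open>a +o I\<close> is the coset of \<open>a\<close>, and addition of cosets is the Minkowski sum. The summand \<open>I\<close>
  in \<open>vscale\<close> matters only for the scalar \<open>0\<close>, where the image of a coset is just \<open>{0}\<close>.
\<close>

definition quotient_struct ::
  "'a::complex_normed_vector set \<Rightarrow> 'a set \<Rightarrow> 'a set normed_struct"
  where "quotient_struct V I =
    \<lparr>carrier = (\<lambda>a. a +o I) ` V, vadd = (+), vzero = I,
     vscale = (\<lambda>c U. scaleC c ` U + I), vnorm = (\<lambda>U. Inf (norm ` U))\<rparr>"

definition direct_sum_struct ::
  "'i set \<Rightarrow> ('i \<Rightarrow> ('b, 'm) normed_struct_scheme) \<Rightarrow> ('i \<Rightarrow> 'b) normed_struct"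
  where "direct_sum_struct K V =
    \<lparr>carrier = (\<Pi>\<^sub>E k\<in>K. carrier (V k)),
     vadd = (\<lambda>f g. \<lambda>k\<in>K. vadd (V k) (f k) (g k)),
     vzero = (\<lambda>k\<in>K. vzero (V k)),
     vscale = (\<lambda>c f. \<lambda>k\<in>K. vscale (V k) c (f k)),
     vnorm = (\<lambda>f. \<Sum>k\<in>K. vnorm (V k) (f k))\<rparr>"

definition bounded_operators ::
  "('b, 'm) normed_struct_scheme \<Rightarrow> ('b \<Rightarrow> 'b) algebra_struct"
  where "bounded_operators V =
    \<lparr>carrier = {T \<in> extensional (carrier V). bounded_clinear_on V V T},
     vadd = (\<lambda>T U. \<lambda>x\<in>carrier V. vadd V (T x) (U x)),
     vzero = (\<lambda>x\<in>carrier V. vzero V),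
     vscale = (\<lambda>c T. \<lambda>x\<in>carrier V. vscale V c (T x)),
     vnorm = (\<lambda>T. SUP x\<in>{x\<in>carrier V. vnorm V x \<le> 1}. vnorm V (T x)),
     amult = compose (carrier V),
     aone = (\<lambda>x\<in>carrier V. x)\<rparr>"

definition abelian_unital_closed_algebra :: "('x::complex_banach \<Rightarrow>\<^sub>L 'x) set \<Rightarrow> bool"
  where "abelian_unital_closed_algebra A \<longleftrightarrow>
    A \<subseteq> clinear_operators \<and> csubspace A \<and>
    (\<forall>a\<in>A. \<forall>b\<in>A. a o\<^sub>L b \<in> A) \<and>
    (\<forall>a\<in>A. \<forall>b\<in>A. a o\<^sub>L b = b o\<^sub>L a) \<and>
    id_blinfun \<in> A \<and>
    closed A"

definition closed_ideal :: "('x::complex_banach \<Rightarrow>\<^sub>L 'x) set \<Rightarrow> ('x \<Rightarrow>\<^sub>L 'x) set \<Rightarrow> bool"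
  where "closed_ideal A I \<longleftrightarrow>
    I \<subseteq> A \<and> csubspace I \<and>
    (\<forall>a\<in>A. \<forall>b\<in>I. a o\<^sub>L b \<in> I \<and> b o\<^sub>L a \<in> I) \<and>
    closed I"

definition orbit :: "('x::complex_banach \<Rightarrow>\<^sub>L 'x) set \<Rightarrow> 'x \<Rightarrow> 'x set"
  where "orbit A x = (\<lambda>a. blinfun_apply a x) ` A"

definition realizes_ssm ::
  "('x::complex_banach \<Rightarrow>\<^sub>L 'x) set \<Rightarrow> nat \<Rightarrow> (nat \<Rightarrow> 'x) \<Rightarrow> bool"
  where "realizes_ssm A p x \<longleftrightarrow>
    1 \<le> p \<and>
    (\<forall>k\<in>{1..p}. closed (orbit A (x k))) \<and>
    (\<forall>v. \<exists>!u. u \<in> (\<Pi>\<^sub>E k\<in>{1..p}. orbit A (x k)) \<and> v = (\<Sum>k\<in>{1..p}. u k))"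

end

theory Submission
  imports Defs
begin

text \<open>
  Take for \<open>I k\<close> the annihilator of \<open>x k\<close> in \<open>A\<close>. The set of all sums \<open>\<Sum>k. a k (x k)\<close> with \<open>a k\<close>
  in the unit ball of \<open>A\<close> is convex, symmetric and, up to dilation, everything; it also contains
  all series \<open>\<Sum>n. b n / 2^(n+1)\<close> of its elements \<open>b n\<close>. Hence, as in the open mapping theorem, there
  is a constant \<open>C\<close> such that every \<open>v\<close> equals \<open>\<Sum>k. a k (x k)\<close> for some \<open>a k\<close> in \<open>A\<close> of norm at
  most \<open>C * norm v\<close>. As the summands \<open>a k (x k)\<close> are determined by \<open>v\<close>, this single estimate bounds
  the inverses of all \<open>S k\<close> and of \<open>S\<close>, and conjugation by \<open>S\<close> gives (iii). Since \<open>A\<close> is abelian it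
  also gives \<open>norm a \<le> C * (\<Sum>k. norm (a (x k)))\<close>. For \<open>p = 2\<close>, if \<open>i n + j n\<close> converges with \<open>i n\<close>
  in \<open>I 1\<close> and \<open>j n\<close> in \<open>I 2\<close>, then \<open>j n (x 1)\<close> converges and \<open>j n (x 2) = 0\<close>, so \<open>j n\<close> is Cauchy
  and the limit of \<open>i n + j n\<close> lies in \<open>I 1 + I 2\<close>.
\<close>

section \<open>Normed spaces on carriers\<close>

context normed_space_on
begin

lemma scale_zero: "x \<in> carrier V \<Longrightarrow> vscale V 0 x = vzero V"
  using norm_scale[of x 0] norm_eq_zero[OF scale_closed[of x 0]] by simp

lemma norm_zero: "vnorm V (vzero V) = 0"
  using norm_eq_zero[OF zero_closed] by simp

lemma scale_vzero: "vscale V c (vzero V) = vzero V"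
  using norm_scale[OF zero_closed, of c] norm_eq_zero[OF scale_closed[OF zero_closed]] norm_zero
  by simp

lemma add_neg: "x \<in> carrier V \<Longrightarrow> vadd V x (vscale V (- 1) x) = vzero V"
  using scale_add_left[of x 1 "- 1"] scale_one[of x] scale_zero[of x] by simp

lemma add_left_commute:
  "\<lbrakk>x \<in> carrier V; y \<in> carrier V; z \<in> carrier V\<rbrakk> \<Longrightarrow> vadd V x (vadd V y z) = vadd V y (vadd V x z)"
  by (metis add_assoc add_commute)

lemma normed_space_on_subset:
  assumes "S \<subseteq> carrier V" "vzero V \<in> S"
    and "\<And>x y. \<lbrakk>x \<in> S; y \<in> S\<rbrakk> \<Longrightarrow> vadd V x y \<in> S"
    and sc: "\<And>c x. x \<in> S \<Longrightarrow> vscale V c x \<in> S"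
  shows "normed_space_on (V\<lparr>carrier := S\<rparr>)"
proof
  have S: "x \<in> carrier V" if "x \<in> S" for x using that assms(1) by auto
  show "\<exists>y\<in>carrier (V\<lparr>carrier := S\<rparr>). vadd (V\<lparr>carrier := S\<rparr>) x y = vzero (V\<lparr>carrier := S\<rparr>)"
    if "x \<in> carrier (V\<lparr>carrier := S\<rparr>)" for x
    using that add_neg[of x] sc[of x "- 1"] S by auto
  show "vadd (V\<lparr>carrier := S\<rparr>) x y = vadd (V\<lparr>carrier := S\<rparr>) y x"
    if "x \<in> carrier (V\<lparr>carrier := S\<rparr>)" "y \<in> carrier (V\<lparr>carrier := S\<rparr>)" for x y
    using that S by (simp add: add_commute)
qed (use assms(2-4) assms(1)[THEN subsetD] in \<open>simp_all add: add_assoc add_zero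
      scale_add_right scale_add_left scale_scale scale_one norm_nonneg norm_eq_zero norm_scale
      norm_triangle\<close>)

end

section \<open>Bounded linear maps and transfer of completeness\<close>

lemma bounded_clinear_on_bound:
  assumes "normed_space_on V" "bounded_clinear_on V W f"
  obtains C where "0 < C" "\<And>x. x \<in> carrier V \<Longrightarrow> vnorm W (f x) \<le> C * vnorm V x"
proof -
  interpret normed_space_on V by fact
  obtain C where C: "\<And>x. x \<in> carrier V \<Longrightarrow> vnorm W (f x) \<le> C * vnorm V x"
    using assms(2) unfolding bounded_clinear_on_def by blast
  \<comment> \<open>The bound in \<open>bounded_clinear_on\<close> may be any real number, even
    negative. The maximum with 1 makes it positive, so that later arguments can divide by
    it.\<close>
  have "vnorm W (f x) \<le> max C 1 * vnorm V x" if "x \<in> carrier V" for x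
    by (rule order_trans[OF C[OF that]]) (simp add: mult_right_mono norm_nonneg that)
  then show thesis by (intro that[of "max C 1"]) auto
qed

text \<open>A lower bound for \<open>f\<close> is an upper bound for its inverse \<open>g\<close>.
  Linearity passes over because \<open>g\<close> can be applied to
  \<open>f (g y) + f (g z) = f (g y + g z)\<close>.\<close>

lemma bounded_clinear_on_inv_into:
  assumes V: "normed_space_on V" and bij: "bij_betw f (carrier V) (carrier W)"
    and f: "bounded_clinear_on V W f"
    and bd: "\<And>x. x \<in> carrier V \<Longrightarrow> vnorm V x \<le> C * vnorm W (f x)"
  shows "bounded_clinear_on W V (inv_into (carrier V) f)"
proof -
  interpret normed_space_on V by fact
  let ?g = "inv_into (carrier V) f"
  note fD = f[unfolded bounded_clinear_on_def]
  have g: "?g y \<in> carrier V" "f (?g y) = y" if "y \<in> carrier W" for y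
    using that bij by (auto simp: bij_betw_def inv_into_into f_inv_into_f)
  have gf: "?g (f x) = x" if "x \<in> carrier V" for x
    using that bij by (simp add: bij_betw_inv_into_left)
  have "?g (vadd W y z) = vadd V (?g y) (?g z)" if "y \<in> carrier W" "z \<in> carrier W" for y z
    using that fD g gf[OF add_closed[OF g(1) g(1)]] by metis
  moreover have "?g (vscale W c y) = vscale V c (?g y)" if "y \<in> carrier W" for c y
    using that fD g gf[OF scale_closed[OF g(1)]] by metis
  moreover have "vnorm V (?g y) \<le> C * vnorm W y" if "y \<in> carrier W" for y
    using bd[OF g(1)[OF that]] g(2)[OF that] by simp
  ultimately show ?thesis
    using g(1) unfolding bounded_clinear_on_def by blast
qed

text \<open>The map \<open>g\<close> carries a Cauchy sequence of \<open>W\<close> to one of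
  \<open>V\<close>; its limit there is mapped by \<open>f\<close> to a limit of the original
  sequence, because \<open>f\<close> undoes \<open>g\<close>.\<close>

lemma complete_transfer:
  assumes V: "banach_space_on V" and W: "normed_space_on W"
    and f: "bounded_clinear_on V W f" and g: "bounded_clinear_on W V g"
    and fg: "\<And>y. y \<in> carrier W \<Longrightarrow> f (g y) = y"
  shows "banach_space_on W"
proof -
  interpret V: banach_space_on V by fact
  interpret W: normed_space_on W by fact
  interpret MV: Metric_space "carrier V" "vdist V" by (rule V.Metric_space_vdist)
  interpret MW: Metric_space "carrier W" "vdist W" by (rule W.Metric_space_vdist)
  obtain B where B: "0 < B" "\<And>x. x \<in> carrier V \<Longrightarrow> vnorm W (f x) \<le> B * vnorm V x"
    using bounded_clinear_on_bound[OF V.normed_space_on_axioms f] by blast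
  obtain C where C: "0 < C" "\<And>y. y \<in> carrier W \<Longrightarrow> vnorm V (g y) \<le> C * vnorm W y"
    using bounded_clinear_on_bound[OF W.normed_space_on_axioms g] by blast
  note fD = f[unfolded bounded_clinear_on_def] and gD = g[unfolded bounded_clinear_on_def]
  have fcl: "f x \<in> carrier W" if "x \<in> carrier V" for x using fD that by auto
  have gcl: "g x \<in> carrier V" if "x \<in> carrier W" for x using gD that by auto
  \<comment> \<open>The distance is the norm of a difference, so a bounded linear map is Lipschitz
    with its norm bound as constant.\<close>
  have df: "vdist W (f x) (f y) \<le> B * vdist V x y" if "x \<in> carrier V" "y \<in> carrier V" for x y
  proof -
    have "vadd W (f x) (vscale W (- 1) (f y)) = f (vadd V x (vscale V (- 1) y))"
      using fD that V.scale_closed by simp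
    then show ?thesis
      using that by (simp add: vdist_def fcl B V.add_closed V.scale_closed)
  qed
  have dg: "vdist V (g x) (g y) \<le> C * vdist W x y" if "x \<in> carrier W" "y \<in> carrier W" for x y
  proof -
    have "vadd V (g x) (vscale V (- 1) (g y)) = g (vadd W x (vscale W (- 1) y))"
      using gD that W.scale_closed by simp
    then show ?thesis
      using that by (simp add: vdist_def gcl C W.add_closed W.scale_closed)
  qed
  have "MW.mcomplete"
    unfolding MW.mcomplete_def
  proof (intro allI impI)
    fix s assume s: "MW.MCauchy s"
    then have sW: "s n \<in> carrier W" for n by (auto simp: MW.MCauchy_def)
    have "MV.MCauchy (\<lambda>n. g (s n))"
      unfolding MV.MCauchy_def
    proof (intro conjI allI impI)
      fix e :: real assume "e > 0"
      then have "e / C > 0" using C by simp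
      then obtain N where N: "\<And>n n'. \<lbrakk>N \<le> n; N \<le> n'\<rbrakk> \<Longrightarrow> vdist W (s n) (s n') < e / C"
        using s unfolding MW.MCauchy_def by blast
      have "vdist V (g (s n)) (g (s n')) < e" if "N \<le> n" "N \<le> n'" for n n'
        using dg[OF sW sW, of n n'] N[OF that] C(1) by (simp add: field_simps)
      then show "\<exists>N. \<forall>n n'. N \<le> n \<longrightarrow> N \<le> n' \<longrightarrow> vdist V (g (s n)) (g (s n')) < e"
        by blast
    qed (use gcl sW in auto)
    then obtain l where l: "limitin MV.mtopology (\<lambda>n. g (s n)) l sequentially"
      using V.complete unfolding MV.mcomplete_def by blast
    then have lV: "l \<in> carrier V" by (simp add: MV.limitin_metric)
    have "limitin MW.mtopology s (f l) sequentially"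
      unfolding MW.limitin_metric
    proof (intro conjI allI impI)
      fix e :: real assume "e > 0"
      then have "e / B > 0" using B by simp
      then have "\<forall>\<^sub>F n in sequentially. g (s n) \<in> carrier V \<and> vdist V (g (s n)) l < e / B"
        using l unfolding MV.limitin_metric by blast
      then show "\<forall>\<^sub>F n in sequentially. s n \<in> carrier W \<and> vdist W (s n) (f l) < e"
      proof eventually_elim
        case (elim n)
        then show ?case
          using df[of "g (s n)" l] fg[OF sW[of n]] lV B(1) sW[of n] by (simp add: field_simps)
      qed
    qed (use fcl lV in auto)
    then show "\<exists>x. limitin MW.mtopology s x sequentially" by blast
  qed
  then show ?thesis by unfold_locales
qed

text \<open>The lower bound takes the place of the open mapping theorem, and completeness of one
  side passes to the other. So completeness of the quotients and of their direct sum comes from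
  orbits and from the whole space, and that of the conjugated algebra comes from
  \<open>A\<close>.\<close>

lemma banach_space_isoI:
  assumes V: "normed_space_on V" and W: "normed_space_on W"
    and complete: "banach_space_on V \<or> banach_space_on W"
    and bij: "bij_betw f (carrier V) (carrier W)"
    and f: "bounded_clinear_on V W f"
    and bd: "\<And>x. x \<in> carrier V \<Longrightarrow> vnorm V x \<le> C * vnorm W (f x)"
  shows "banach_space_iso V W f"
proof -
  have g: "bounded_clinear_on W V (inv_into (carrier V) f)"
    using bounded_clinear_on_inv_into[OF V bij f bd] .
  have "banach_space_on V \<and> banach_space_on W"
    using complete complete_transfer[OF _ W f g] complete_transfer[OF _ V g f] bij
    by (auto simp: bij_betw_inv_into_left bij_betw_inv_into_right)
  then show ?thesis
    using bij f g by (simp add: banach_space_iso_def)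
qed

section \<open>Linear subspaces as normed and Banach spaces\<close>

lemma normed_space_on_csubspace:
  assumes V: "csubspace (carrier V)"
    "vadd V = (+)" "vzero V = 0" "vscale V = scaleC" "vnorm V = norm"
  shows "normed_space_on V"
proof
  have one: "1 *\<^sub>C x = x" for x :: 'a using scaleR_scaleC[of 1 x] by simp
  have m: "x + (- 1) *\<^sub>C x = 0" for x :: 'a
    using scaleC_add_left[of 1 "-1" x] scaleR_scaleC[of 0 x] by (simp add: one)
  show "\<exists>y\<in>carrier V. vadd V x y = vzero V" if "x \<in> carrier V" for x
    using that V m[of x] by (metis csubspace_def)
  show "vscale V 1 x = x" for x by (simp add: V one)
qed (use V in \<open>auto simp: csubspace_def scaleC_add_right scaleC_add_left scaleC_scaleC norm_scaleC
      norm_triangle_ineq\<close>)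

lemma scaleC_minus_one: "(- 1) *\<^sub>C x = - (x :: 'a::complex_normed_vector)"
  using scaleR_scaleC[of "-1" x] by simp

lemma csubspace_diff: "\<lbrakk>csubspace V; x \<in> V; y \<in> V\<rbrakk> \<Longrightarrow> x - y \<in> V"
  unfolding csubspace_def by (metis scaleC_minus_one diff_conv_add_uminus)

text \<open>On the carrier the distance is the ambient one, and a closed subset of a complete space
  is complete. Prescribing the fields instead of the record lets the lemma serve both
  \<open>subspace_struct\<close> and \<open>operator_algebra\<close>.\<close>

lemma banach_space_on_csubspace:
  fixes V :: "('a::complex_banach, 'm) normed_struct_scheme"
  assumes V: "csubspace (carrier V)" "closed (carrier V)"
    "vadd V = (+)" "vzero V = 0" "vscale V = scaleC" "vnorm V = norm"
  shows "banach_space_on V"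
proof -
  interpret normed_space_on V by (rule normed_space_on_csubspace) (use V in auto)
  interpret M: Metric_space "carrier V" "vdist V" by (rule Metric_space_vdist)
  have d: "vdist V x y = dist x y" if "x \<in> carrier V" "y \<in> carrier V" for x y
    using that by (simp add: vdist_def V scaleC_minus_one dist_norm)
  have "M.mcomplete"
    unfolding M.mcomplete_def
  proof (intro allI impI)
    fix s assume s: "M.MCauchy s"
    then have sV: "s n \<in> carrier V" for n by (auto simp: M.MCauchy_def)
    have "Cauchy s"
      using s by (simp add: M.MCauchy_def Cauchy_def d sV)
    then obtain l where l: "s \<longlonglongrightarrow> l" using Cauchy_convergent convergent_def by blast
    then have lV: "l \<in> carrier V" using V(2) sV closed_sequentially by blast
    have "limitin M.mtopology s l sequentially"
      using l by (simp add: M.limitin_metric lV sV d tendsto_iff)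
    then show "\<exists>x. limitin M.mtopology s x sequentially" by blast
  qed
  then show ?thesis by unfold_locales
qed

lemma banach_algebra_on_operator_algebra:
  assumes "A \<subseteq> clinear_operators" "csubspace A" "closed A" "id_blinfun \<in> A"
    and "\<And>a b. \<lbrakk>a \<in> A; b \<in> A\<rbrakk> \<Longrightarrow> a o\<^sub>L b \<in> A"
  shows "banach_algebra_on (operator_algebra (A :: ('x::complex_banach \<Rightarrow>\<^sub>L 'x) set))"
proof -
  interpret banach_space_on "operator_algebra A"
    by (rule banach_space_on_csubspace) (use assms in \<open>auto simp: operator_algebra_def\<close>)
  have cl: "blinfun_apply a (c *\<^sub>C v) = c *\<^sub>C blinfun_apply a v" if "a \<in> A" for a c v
    using that assms(1) by (auto simp: clinear_operators_def)
  have sel: "carrier (operator_algebra A) = A" "vadd (operator_algebra A) = (+)"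
    "vscale (operator_algebra A) = scaleC" "vnorm (operator_algebra A) = norm"
    "amult (operator_algebra A) = (o\<^sub>L)" "aone (operator_algebra A) = id_blinfun"
    by (simp_all add: operator_algebra_def)
  show ?thesis
  proof (unfold_locales, unfold sel)
    fix a b c :: "'x \<Rightarrow>\<^sub>L 'x" and z
    assume a: "a \<in> A"
    show "(a o\<^sub>L b) o\<^sub>L c = a o\<^sub>L (b o\<^sub>L c)" by (rule blinfun_eqI) simp
    show "id_blinfun o\<^sub>L a = a" "a o\<^sub>L id_blinfun = a" by (rule blinfun_eqI, simp)+
    show "(a + b) o\<^sub>L c = (a o\<^sub>L c) + (b o\<^sub>L c)" "a o\<^sub>L (b + c) = (a o\<^sub>L b) + (a o\<^sub>L c)"
      by (rule blinfun_eqI, simp add: blinfun.bilinear_simps)+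
    \<comment> \<open>The second identity uses that \<open>a\<close> is complex linear; the operator
      type by itself gives real linearity only.\<close>
    show "(z *\<^sub>C a) o\<^sub>L b = z *\<^sub>C (a o\<^sub>L b)" "a o\<^sub>L (z *\<^sub>C b) = z *\<^sub>C (a o\<^sub>L b)"
      by (rule blinfun_eqI, simp add: scaleC_blinfun.rep_eq cl[OF a])+
    show "norm (a o\<^sub>L b) \<le> norm a * norm b" by (rule norm_blinfun_compose)
  qed (use assms in auto)
qed

section \<open>Quotients and direct sums\<close>

lemma coset_add:
  assumes "csubspace I"
  shows "(a +o I) + (b +o I) = (a + b) +o I"
proof -
  have "I + I = I" using assms by (force simp: set_plus_def csubspace_def)
  then show ?thesis by (simp add: set_plus_rearrange)
qed

lemma coset_scale:
  assumes I: "csubspace I"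
  shows "scaleC c ` (a +o I) + I = (c *\<^sub>C a) +o I"
proof (intro equalityI subsetI)
  fix z assume "z \<in> (c *\<^sub>C a) +o I"
  then obtain i where i: "i \<in> I" "z = c *\<^sub>C a + i" by (auto simp: elt_set_plus_def)
  moreover have "a \<in> a +o I"
    using I by (auto simp: csubspace_def elt_set_plus_def)
  ultimately show "z \<in> scaleC c ` (a +o I) + I" by blast
next
  fix z assume "z \<in> scaleC c ` (a +o I) + I"
  then obtain i j where "i \<in> I" "j \<in> I" "z = c *\<^sub>C (a + i) + j"
    by (auto simp: elt_set_plus_def set_plus_def)
  then show "z \<in> (c *\<^sub>C a) +o I"
    using I by (auto simp: csubspace_def elt_set_plus_def scaleC_add_right add.assoc
        intro!: bexI[where x = "c *\<^sub>C i + j"])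
qed

lemma coset_eq_iff:
  assumes I: "csubspace I"
  shows "a +o I = b +o I \<longleftrightarrow> a - b \<in> I"
proof
  assume eq: "a +o I = b +o I"
  have "a \<in> a +o I" using I by (auto simp: csubspace_def elt_set_plus_def)
  then show "a - b \<in> I" using eq set_plus_imp_minus by blast
next
  assume ab: "a - b \<in> I"
  have "a +o I = b +o ((a - b) +o I)" by (simp add: set_plus_rearrange2)
  also have "(a - b) +o I = I"
  proof (intro equalityI subsetI)
    fix z assume "z \<in> I"
    then show "z \<in> (a - b) +o I"
      using csubspace_diff[OF I _ ab] by (simp add: set_minus_plus[symmetric])
  qed (use ab I in \<open>auto simp: csubspace_def elt_set_plus_def\<close>)
  finally show "a +o I = b +o I" .
qed

lemma Inf_norm_coset_le: "i \<in> I \<Longrightarrow> Inf (norm ` (a +o I)) \<le> norm (a + i :: 'a::real_normed_vector)"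
  by (intro cInf_lower) (auto intro: bdd_belowI[where m = 0])

lemma Inf_norm_coset_approx:
  fixes a :: "'a::real_normed_vector"
  assumes "I \<noteq> {}" "e > 0"
  obtains i where "i \<in> I" "norm (a + i) < Inf (norm ` (a +o I)) + e"
proof -
  have "norm ` (a +o I) \<noteq> {}" using assms(1) by (auto simp: elt_set_plus_def)
  then obtain y where "y \<in> norm ` (a +o I)" "y < Inf (norm ` (a +o I)) + e"
    using cInf_lessD[of "norm ` (a +o I)" "Inf (norm ` (a +o I)) + e"] assms(2) by auto
  then show thesis using that by (auto simp: elt_set_plus_def)
qed

text \<open>The algebraic axioms are inherited from representatives. The norm axioms come from
  representatives whose norm is within \<open>e\<close> of the infimum, and definiteness from the
  closedness of \<open>I\<close>.\<close>

lemma normed_space_on_quotient: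
  fixes V :: "'a::complex_normed_vector set"
  assumes V: "csubspace V" and I: "csubspace I" "I \<subseteq> V" "closed I"
  shows "normed_space_on (quotient_struct V I)"
proof -
  let ?q = "\<lambda>a. a +o I" and ?n = "\<lambda>U :: 'a set. Inf (norm ` U)"
  note VD = V[unfolded csubspace_def] and ID = I(1)[unfolded csubspace_def]
  note simps = quotient_struct_def coset_add[OF I(1)] coset_scale[OF I(1)]
  have one: "1 *\<^sub>C v = v" for v :: 'a using scaleR_scaleC[of 1 v] by simp
  have zero: "0 *\<^sub>C v = 0" for v :: 'a using scaleR_scaleC[of 0 v] by simp
  have ne: "I \<noteq> {}" using ID by auto
  have nonneg: "0 \<le> ?n (?q a)" for a
    by (intro cInf_greatest) (use ne in \<open>auto simp: elt_set_plus_def\<close>)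
  \<comment> \<open>If the infimum is 0, then \<open>I\<close> has elements arbitrarily close to
    \<open>- a\<close>, hence contains \<open>- a\<close> because it is closed.\<close>
  have nz: "?q a = I" if n: "?n (?q a) = 0" for a
  proof -
    have "\<exists>i\<in>I. dist i (- a) < e" if "e > 0" for e
      using Inf_norm_coset_approx[OF ne that, of a] n
      by (metis add_0 add.commute diff_minus_eq_add dist_norm)
    then have "- a \<in> closure I" by (simp add: closure_approachable)
    then have "0 - a \<in> I" using I(3) by simp
    then have "a \<in> I" using csubspace_diff[OF I(1), of 0 "0 - a"] ID by simp
    then show ?thesis using coset_eq_iff[OF I(1), of a 0] by simp
  qed
  have nI: "?n I = 0"
    using Inf_norm_coset_le[of 0 I 0] nonneg[of 0] ID by simp
  \<comment> \<open>The tolerance \<open>e / cmod c\<close> turns into \<open>e\<close> after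
    multiplication by \<open>c\<close>.\<close>
  have scale_le: "?n (?q (c *\<^sub>C a)) \<le> cmod c * ?n (?q a)" if c: "c \<noteq> 0" for c a
  proof (rule field_le_epsilon)
    fix e :: real assume "e > 0"
    then obtain i where i: "i \<in> I" "norm (a + i) < ?n (?q a) + e / cmod c"
      using Inf_norm_coset_approx[OF ne, of "e / cmod c" a] c by auto
    have "?n (?q (c *\<^sub>C a)) \<le> norm (c *\<^sub>C a + c *\<^sub>C i)"
      by (rule Inf_norm_coset_le) (use i ID in auto)
    also have "\<dots> = cmod c * norm (a + i)"
      by (metis norm_scaleC scaleC_add_right)
    also have "\<dots> \<le> cmod c * (?n (?q a) + e / cmod c)"
      using i by (intro mult_left_mono) auto
    also have "\<dots> = cmod c * ?n (?q a) + e"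
      using c by (simp add: distrib_left)
    finally show "?n (?q (c *\<^sub>C a)) \<le> cmod c * ?n (?q a) + e" .
  qed
  \<comment> \<open>The reverse inequality is the same estimate for the scalar
    \<open>inverse c\<close> and the vector \<open>c *\<^sub>C a\<close>.\<close>
  have scale: "?n (?q (c *\<^sub>C a)) = cmod c * ?n (?q a)" for c a
  proof (cases "c = 0")
    case False
    have "?n (?q a) \<le> inverse (cmod c) * ?n (?q (c *\<^sub>C a))"
      using scale_le[of "inverse c" "c *\<^sub>C a"] False
      by (simp add: scaleC_scaleC one norm_inverse)
    then have "cmod c * ?n (?q a) \<le> ?n (?q (c *\<^sub>C a))"
      using False by (simp add: field_simps)
    with scale_le[OF False, of a] show ?thesis by simp
  qed (simp add: zero nI)
  have tri: "?n (?q (a + b)) \<le> ?n (?q a) + ?n (?q b)" for a b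
  proof (rule field_le_epsilon)
    fix e :: real assume "e > 0"
    then have e: "e / 2 > 0" by simp
    obtain i where i: "i \<in> I" "norm (a + i) < ?n (?q a) + e / 2"
      using Inf_norm_coset_approx[OF ne e] by blast
    obtain j where j: "j \<in> I" "norm (b + j) < ?n (?q b) + e / 2"
      using Inf_norm_coset_approx[OF ne e] by blast
    have "?n (?q (a + b)) \<le> norm ((a + b) + (i + j))"
      by (rule Inf_norm_coset_le) (use i j ID in auto)
    also have "\<dots> \<le> norm (a + i) + norm (b + j)"
      by (metis add.assoc add.left_commute norm_triangle_ineq)
    finally show "?n (?q (a + b)) \<le> ?n (?q a) + ?n (?q b) + e" using i j by simp
  qed
  have neg: "\<exists>b\<in>V. ?q (a + b) = I" if "a \<in> V" for a
    using csubspace_diff[OF V, of 0 a] that VD by (intro bexI[of _ "0 - a"]) auto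
  let ?Q = "quotient_struct V I"
  \<comment> \<open>With the zero written as the coset of \<open>0\<close>, all operations act on
    representatives, and each axiom becomes a statement about elements of \<open>V\<close>.\<close>
  have sel: "vadd ?Q (?q a) (?q b) = ?q (a + b)" "vscale ?Q c (?q a) = ?q (c *\<^sub>C a)"
    "vzero ?Q = ?q 0" "vnorm ?Q (?q a) = ?n (?q a)" for a b c
    by (simp_all add: simps)
  have mem: "?q a \<in> carrier ?Q" if "a \<in> V" for a
    using that by (simp add: quotient_struct_def)
  have cases: thesis if "U \<in> carrier ?Q" "\<And>a. \<lbrakk>a \<in> V; U = ?q a\<rbrakk> \<Longrightarrow> thesis" for U thesis
    using that by (auto simp: quotient_struct_def)
  show ?thesis
  proof
    show "vzero ?Q \<in> carrier ?Q" unfolding sel using VD by (intro mem) auto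
    fix U assume "U \<in> carrier ?Q"
    then obtain a where a: "a \<in> V" "U = ?q a" by (rule cases)
    show "vscale ?Q c U \<in> carrier ?Q" for c
      unfolding a(2) sel using VD a(1) by (intro mem) auto
    show "vadd ?Q U (vzero ?Q) = U" unfolding a(2) sel by simp
    show "\<exists>W\<in>carrier ?Q. vadd ?Q U W = vzero ?Q"
    proof -
      obtain b where "b \<in> V" "?q (a + b) = I" using neg[OF a(1)] by blast
      then show ?thesis unfolding a(2) by (intro bexI[OF _ mem[of b]]) (simp_all add: sel)
    qed
    show "vscale ?Q (c + d) U = vadd ?Q (vscale ?Q c U) (vscale ?Q d U)" for c d
      unfolding a(2) sel scaleC_add_left ..
    show "vscale ?Q c (vscale ?Q d U) = vscale ?Q (c * d) U" for c d
      unfolding a(2) sel scaleC_scaleC ..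
    show "vscale ?Q 1 U = U" unfolding a(2) sel one ..
    show "0 \<le> vnorm ?Q U" unfolding a(2) sel by (rule nonneg)
    show "vnorm ?Q U = 0 \<longleftrightarrow> U = vzero ?Q"
      unfolding a(2) sel using nz[of a] nI by auto
    show "vnorm ?Q (vscale ?Q c U) = cmod c * vnorm ?Q U" for c
      unfolding a(2) sel by (rule scale)
    fix W assume "W \<in> carrier ?Q"
    then obtain b where b: "b \<in> V" "W = ?q b" by (rule cases)
    show "vadd ?Q U W \<in> carrier ?Q"
      unfolding a(2) b(2) sel using VD a(1) b(1) by (intro mem) auto
    show "vadd ?Q U W = vadd ?Q W U" unfolding a(2) b(2) sel by (simp add: add.commute)
    show "vscale ?Q c (vadd ?Q U W) = vadd ?Q (vscale ?Q c U) (vscale ?Q c W)" for c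
      unfolding a(2) b(2) sel scaleC_add_right ..
    show "vnorm ?Q (vadd ?Q U W) \<le> vnorm ?Q U + vnorm ?Q W"
      unfolding a(2) b(2) sel by (rule tri)
    fix Z assume "Z \<in> carrier ?Q"
    then obtain c where c: "c \<in> V" "Z = ?q c" by (rule cases)
    show "vadd ?Q (vadd ?Q U W) Z = vadd ?Q U (vadd ?Q W Z)"
      unfolding a(2) b(2) c(2) sel by (simp add: add.assoc)
  qed
qed

section \<open>Finite direct sums\<close>

lemma normed_space_on_direct_sum:
  assumes K: "finite K" and V: "\<And>k. k \<in> K \<Longrightarrow> normed_space_on (V k)"
  shows "normed_space_on (direct_sum_struct K V)"
proof
  let ?D = "direct_sum_struct K V"
  note V' = normed_space_on.add_closed[OF V] normed_space_on.zero_closed[OF V]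
    normed_space_on.scale_closed[OF V] normed_space_on.norm_nonneg[OF V]
    normed_space_on.scale_one[OF V] normed_space_on.scale_scale[OF V]
    normed_space_on.scale_add_right[OF V] normed_space_on.scale_add_left[OF V]
    normed_space_on.add_zero[OF V] normed_space_on.norm_scale[OF V]
    normed_space_on.add_assoc[OF V]
  fix f assume f: "f \<in> carrier ?D"
  then have fk: "f k \<in> carrier (V k)" if "k \<in> K" for k
    using that by (auto simp: direct_sum_struct_def)
  \<comment> \<open>Vectors take the value \<open>undefined\<close> outside \<open>K\<close>. This
    matters for identities that compare a restricted function with \<open>f\<close> itself.\<close>
  have ext: "f k = undefined" if "k \<notin> K" for k
    using that f by (auto simp: direct_sum_struct_def)
  {
    fix g assume g: "g \<in> carrier ?D"
    then have gk: "g k \<in> carrier (V k)" if "k \<in> K" for k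
      using that by (auto simp: direct_sum_struct_def)
    show "vadd ?D f g \<in> carrier ?D"
      using fk gk by (auto simp: direct_sum_struct_def V')
    show "vadd ?D f g = vadd ?D g f"
      using fk gk by (auto simp: direct_sum_struct_def normed_space_on.add_commute[OF V])
    show "vscale ?D c (vadd ?D f g)
      = vadd ?D (vscale ?D c f) (vscale ?D c g)" for c
      using fk gk by (auto simp: direct_sum_struct_def V')
    show "vnorm ?D (vadd ?D f g)
      \<le> vnorm ?D f + vnorm ?D g"
      using fk gk by (auto simp: direct_sum_struct_def sum.distrib[symmetric] 
          intro!: sum_mono normed_space_on.norm_triangle[OF V])
    fix h assume h: "h \<in> carrier ?D"
    then have hk: "h k \<in> carrier (V k)" if "k \<in> K" for k
      using that by (auto simp: direct_sum_struct_def)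
    show "vadd ?D (vadd ?D f g) h
      = vadd ?D f (vadd ?D g h)"
      using fk gk hk by (auto simp: direct_sum_struct_def V')
  }
  show "vscale ?D c f \<in> carrier ?D" for c
    using fk by (auto simp: direct_sum_struct_def V')
  show "vadd ?D f (vzero ?D) = f"
    using fk ext by (auto simp: direct_sum_struct_def V')
  show "vscale ?D 1 f = f"
    using fk ext by (auto simp: direct_sum_struct_def V')
  show "vscale ?D c (vscale ?D d f)
     = vscale ?D (c * d) f" for c d
    using fk by (auto simp: direct_sum_struct_def V')
  show "vscale ?D (c + d) f
     = vadd ?D (vscale ?D c f) (vscale ?D d f)" for c d
    using fk by (auto simp: direct_sum_struct_def V')
  show "0 \<le> vnorm ?D f"
    using fk by (auto simp: direct_sum_struct_def V' intro!: sum_nonneg)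
  show "vnorm ?D (vscale ?D c f)
     = cmod c * vnorm ?D f" for c
    using fk by (auto simp: direct_sum_struct_def V' sum_distrib_left)
  show "\<exists>g\<in>carrier ?D.
      vadd ?D f g = vzero ?D"
    using fk by (intro bexI[of _ "\<lambda>k\<in>K. vscale (V k) (- 1) (f k)"])
      (auto simp: direct_sum_struct_def V' normed_space_on.add_neg[OF V])
  show "vnorm ?D f = 0 \<longleftrightarrow> f = vzero ?D"
  proof -
    have "vnorm ?D f = 0 \<longleftrightarrow> (\<forall>k\<in>K. vnorm (V k) (f k) = 0)"
      using fk K by (simp add: direct_sum_struct_def sum_nonneg_eq_0_iff V')
    also have "\<dots> \<longleftrightarrow> (\<forall>k\<in>K. f k = vzero (V k))"
      using fk by (simp add: normed_space_on.norm_eq_zero[OF V])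
    also have "\<dots> \<longleftrightarrow> f = vzero ?D"
      using ext by (auto simp: direct_sum_struct_def fun_eq_iff restrict_def)
    finally show ?thesis .
  qed
qed (auto simp: direct_sum_struct_def normed_space_on.zero_closed[OF V])

section \<open>Bounded operators\<close>

lemma bounded_clinear_on_compose:
  assumes "normed_space_on V" "bounded_clinear_on V W f" "normed_space_on W" "bounded_clinear_on W Z g"
  shows "bounded_clinear_on V Z (\<lambda>x. g (f x))"
proof -
  obtain B where B: "0 < B" "\<And>x. x \<in> carrier V \<Longrightarrow> vnorm W (f x) \<le> B * vnorm V x"
    using bounded_clinear_on_bound[OF assms(1,2)] by blast
  obtain C where C: "0 < C" "\<And>x. x \<in> carrier W \<Longrightarrow> vnorm Z (g x) \<le> C * vnorm W x"
    using bounded_clinear_on_bound[OF assms(3,4)] by blast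
  note fD = assms(2)[unfolded bounded_clinear_on_def] and gD = assms(4)[unfolded bounded_clinear_on_def]
  have fcl: "f x \<in> carrier W" if "x \<in> carrier V" for x using fD that by auto
  have "vnorm Z (g (f x)) \<le> (C * B) * vnorm V x" if "x \<in> carrier V" for x
  proof -
    have "vnorm Z (g (f x)) \<le> C * vnorm W (f x)" using C fcl[OF that] by simp
    also have "\<dots> \<le> C * (B * vnorm V x)" using B C that by (intro mult_left_mono) auto
    finally show ?thesis by (simp add: mult.assoc)
  qed
  then show ?thesis
    using fD gD fcl unfolding bounded_clinear_on_def by (auto intro!: exI[of _ "C * B"])
qed

text \<open>Operators are stored in \<open>bounded_operators\<close> as restrictions to the carrier;
  this allows passing between a map and its restriction.\<close>

lemma bounded_clinear_on_cong:
  assumes "normed_space_on V" "\<And>x. x \<in> carrier V \<Longrightarrow> f x = g x"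
  shows "bounded_clinear_on V W f \<longleftrightarrow> bounded_clinear_on V W g"
  using assms(2) normed_space_on.add_closed[OF assms(1)] normed_space_on.scale_closed[OF assms(1)]
  by (simp add: bounded_clinear_on_def Pi_iff)

context normed_space_on
begin

lemma bounded_clinear_on_add:
  assumes T: "bounded_clinear_on V V T" and U: "bounded_clinear_on V V U"
  shows "bounded_clinear_on V V (\<lambda>x. vadd V (T x) (U x))"
proof -
  obtain B where B: "\<And>x. x \<in> carrier V \<Longrightarrow> vnorm V (T x) \<le> B * vnorm V x"
    using bounded_clinear_on_bound[OF normed_space_on_axioms T] by blast
  obtain C where C: "\<And>x. x \<in> carrier V \<Longrightarrow> vnorm V (U x) \<le> C * vnorm V x"
    using bounded_clinear_on_bound[OF normed_space_on_axioms U] by blast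
  note TD = T[unfolded bounded_clinear_on_def] and UD = U[unfolded bounded_clinear_on_def]
  have cl: "T x \<in> carrier V" "U x \<in> carrier V" if "x \<in> carrier V" for x using TD UD that by auto
  have "vnorm V (vadd V (T x) (U x)) \<le> (B + C) * vnorm V x" if "x \<in> carrier V" for x
    using norm_triangle[OF cl[OF that]] B[OF that] C[OF that] by (simp add: distrib_right)
  then show ?thesis
    using TD UD cl unfolding bounded_clinear_on_def
    by (auto simp: add_closed scale_add_right add_assoc add_left_commute intro!: exI[of _ "B + C"])
qed

lemma bounded_clinear_on_scale:
  assumes T: "bounded_clinear_on V V T"
  shows "bounded_clinear_on V V (\<lambda>x. vscale V c (T x))"
proof -
  obtain B where B: "\<And>x. x \<in> carrier V \<Longrightarrow> vnorm V (T x) \<le> B * vnorm V x"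
    using bounded_clinear_on_bound[OF normed_space_on_axioms T] by blast
  note TD = T[unfolded bounded_clinear_on_def]
  have cl: "T x \<in> carrier V" if "x \<in> carrier V" for x using TD that by auto
  have "vnorm V (vscale V c (T x)) \<le> (cmod c * B) * vnorm V x" if "x \<in> carrier V" for x
    using B[OF that] by (simp add: norm_scale cl that mult.assoc mult_left_mono)
  then show ?thesis
    using TD cl unfolding bounded_clinear_on_def
    by (auto simp: scale_closed scale_add_right scale_scale mult.commute intro!: exI[of _ "cmod c * B"])
qed

lemma bounded_clinear_on_zero: "bounded_clinear_on V V (\<lambda>x. vzero V)"
  unfolding bounded_clinear_on_def
  by (auto simp: zero_closed add_zero scale_vzero norm_zero intro!: exI[of _ 0])

text \<open>The operator norm is a supremum of reals, which dominates the family only when that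
  family is bounded above.\<close>

lemma bounded_clinear_on_bdd_above:
  assumes T: "bounded_clinear_on V W T"
  shows "bdd_above ((\<lambda>x. vnorm W (T x)) ` {x \<in> carrier V. vnorm V x \<le> 1})"
proof -
  obtain C where C: "0 < C" "\<And>x. x \<in> carrier V \<Longrightarrow> vnorm W (T x) \<le> C * vnorm V x"
    using bounded_clinear_on_bound[OF normed_space_on_axioms T] by blast
  have "vnorm W (T x) \<le> C" if "x \<in> carrier V" "vnorm V x \<le> 1" for x
    using C(2)[OF that(1)] mult_left_le[OF that(2), of C] C(1) by linarith
  then show ?thesis by (intro bdd_aboveI2[where M = C]) auto
qed

text \<open>A nonzero vector is rescaled to norm 1, where the supremum applies; the zero vector is
  treated separately through the bound \<open>C\<close>.\<close>

lemma bounded_operators_norm_upper: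
  assumes T: "T \<in> carrier (bounded_operators V)" and x: "x \<in> carrier V"
  shows "vnorm V (T x) \<le> vnorm (bounded_operators V) T * vnorm V x"
proof -
  let ?B = "{x \<in> carrier V. vnorm V x \<le> 1}"
  have T': "bounded_clinear_on V V T" using T by (simp add: bounded_operators_def)
  note TD = T'[unfolded bounded_clinear_on_def]
  have cl: "T x \<in> carrier V" if "x \<in> carrier V" for x using TD that by auto
  obtain C where C: "0 < C" "\<And>x. x \<in> carrier V \<Longrightarrow> vnorm V (T x) \<le> C * vnorm V x"
    using bounded_clinear_on_bound[OF normed_space_on_axioms T'] by blast
  have up: "vnorm V (T y) \<le> vnorm (bounded_operators V) T" if "y \<in> ?B" for y
    using cSUP_upper[OF that bounded_clinear_on_bdd_above[OF T']] by (simp add: bounded_operators_def)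
  show ?thesis
  proof (cases "x = vzero V")
    case True
    then show ?thesis using C(2)[OF x] norm_nonneg[OF cl[OF x]] by (simp add: norm_zero)
  next
    case False
    then have n: "vnorm V x > 0" using norm_eq_zero[OF x] norm_nonneg[OF x] by simp
    let ?c = "complex_of_real (inverse (vnorm V x))"
    have "vnorm V (T (vscale V ?c x)) \<le> vnorm (bounded_operators V) T"
      by (rule up) (use n x in \<open>simp add: scale_closed norm_scale norm_inverse\<close>)
    moreover have "T (vscale V ?c x) = vscale V ?c (T x)"
      using TD x by blast
    ultimately have "inverse (vnorm V x) * vnorm V (T x) \<le> vnorm (bounded_operators V) T"
      using n by (simp add: norm_scale cl x norm_inverse)
    then show ?thesis using n by (simp add: field_simps)
  qed
qed

text \<open>Norms at most 1 only decrease the nonnegative \<open>C\<close>, and the zero vector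
  keeps the supremum from being taken over the empty set. With
  \<open>bounded_operators_norm_upper\<close> this replaces the supremum in the estimates
  below.\<close>

lemma bounded_operators_norm_least:
  assumes "0 \<le> C" "\<And>x. x \<in> carrier V \<Longrightarrow> vnorm V (T x) \<le> C * vnorm V x"
  shows "vnorm (bounded_operators V) T \<le> C"
proof -
  have "(SUP x\<in>{x \<in> carrier V. vnorm V x \<le> 1}. vnorm V (T x)) \<le> C"
  proof (rule cSUP_least)
    show "{x \<in> carrier V. vnorm V x \<le> 1} \<noteq> {}"
      using zero_closed norm_zero by auto
    fix x assume "x \<in> {x \<in> carrier V. vnorm V x \<le> 1}"
    then show "vnorm V (T x) \<le> C"
      using assms(2)[of x] mult_left_le[of "vnorm V x" C] assms(1) by simp
  qed
  then show ?thesis by (simp add: bounded_operators_def)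
qed

lemma bounded_operators_norm_nonneg:
  assumes T: "T \<in> carrier (bounded_operators V)"
  shows "0 \<le> vnorm (bounded_operators V) T"
proof -
  let ?B = "{x \<in> carrier V. vnorm V x \<le> 1}"
  have T': "bounded_clinear_on V V T" using T by (simp add: bounded_operators_def)
  have z: "vzero V \<in> ?B" using zero_closed norm_zero by auto
  have "0 \<le> vnorm V (T (vzero V))"
    using T' zero_closed norm_nonneg by (auto simp: bounded_clinear_on_def)
  also have "\<dots> \<le> (SUP x\<in>?B. vnorm V (T x))"
    by (rule cSUP_upper[OF z bounded_clinear_on_bdd_above[OF T']])
  finally show ?thesis by (simp add: bounded_operators_def)
qed

lemma bounded_operators_mem:
  "bounded_clinear_on V V T \<Longrightarrow> restrict T (carrier V) \<in> carrier (bounded_operators V)"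
  using bounded_clinear_on_cong[OF normed_space_on_axioms, of "restrict T (carrier V)" T V]
  by (simp add: bounded_operators_def)

lemma bounded_operators_memD:
  assumes T: "T \<in> carrier (bounded_operators V)"
  shows "bounded_clinear_on V V T" "T \<in> extensional (carrier V)"
    "x \<in> carrier V \<Longrightarrow> T x \<in> carrier V"
  using T by (auto simp: bounded_operators_def bounded_clinear_on_def)

lemma normed_space_on_bounded_operators: "normed_space_on (bounded_operators V)"
proof
  let ?B = "bounded_operators V"
  have sel: "vadd ?B T U = (\<lambda>x\<in>carrier V. vadd V (T x) (U x))"
    "vzero ?B = (\<lambda>x\<in>carrier V. vzero V)" "vscale ?B c T = (\<lambda>x\<in>carrier V. vscale V c (T x))" for T U c
    by (simp_all add: bounded_operators_def)
  note mem = bounded_operators_memD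
  show z: "vzero ?B \<in> carrier ?B" unfolding sel by (intro bounded_operators_mem bounded_clinear_on_zero)
  fix T assume T: "T \<in> carrier ?B"
  note up = bounded_operators_norm_upper
  show sc: "vscale ?B c T \<in> carrier ?B" for c
    unfolding sel by (intro bounded_operators_mem bounded_clinear_on_scale mem(1)[OF T])
  {
    fix U assume U: "U \<in> carrier ?B"
    show "vadd ?B T U \<in> carrier ?B"
      unfolding sel by (intro bounded_operators_mem bounded_clinear_on_add mem(1)[OF T] mem(1)[OF U])
    show "vadd ?B T U = vadd ?B U T"
      using mem(3)[OF T] mem(3)[OF U] by (auto simp: sel add_commute)
    show "vscale ?B c (vadd ?B T U) = vadd ?B (vscale ?B c T) (vscale ?B c U)" for c
      using mem(3)[OF T] mem(3)[OF U] by (auto simp: sel scale_add_right)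
    show "vnorm ?B (vadd ?B T U) \<le> vnorm ?B T + vnorm ?B U"
    proof (rule bounded_operators_norm_least)
      fix x assume x: "x \<in> carrier V"
      show "vnorm V (vadd ?B T U x) \<le> (vnorm ?B T + vnorm ?B U) * vnorm V x"
        using norm_triangle[OF mem(3)[OF T x] mem(3)[OF U x]] up[OF T x] up[OF U x] x
        by (simp add: sel distrib_right)
    qed (simp add: T U bounded_operators_norm_nonneg)
    show "vadd ?B (vadd ?B T U) W = vadd ?B T (vadd ?B U W)" if W: "W \<in> carrier ?B" for W
      using mem(3)[OF T] mem(3)[OF U] mem(3)[OF W] by (auto simp: sel add_assoc)
  }
  show "vadd ?B T (vzero ?B) = T"
    using mem(3)[OF T] by (intro extensionalityI[OF _ mem(2)[OF T]]) (auto simp: sel add_zero)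
  show "\<exists>U\<in>carrier ?B. vadd ?B T U = vzero ?B"
    using mem(3)[OF T] by (intro bexI[OF _ sc[of "- 1"]]) (auto simp: sel add_neg)
  show "vscale ?B (c + d) T = vadd ?B (vscale ?B c T) (vscale ?B d T)" for c d
    using mem(3)[OF T] by (auto simp: sel scale_add_left)
  show "vscale ?B c (vscale ?B d T) = vscale ?B (c * d) T" for c d
    using mem(3)[OF T] by (auto simp: sel scale_scale)
  show "vscale ?B 1 T = T"
    using mem(3)[OF T] by (intro extensionalityI[OF _ mem(2)[OF T]]) (auto simp: sel scale_one)
  show "0 \<le> vnorm ?B T" by (rule bounded_operators_norm_nonneg[OF T])
  show "vnorm ?B T = 0 \<longleftrightarrow> T = vzero ?B"
  proof
    assume 0: "vnorm ?B T = 0"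
    have "T x = vzero V" if x: "x \<in> carrier V" for x
      using up[OF T x] 0 norm_nonneg[OF mem(3)[OF T x]] norm_eq_zero[OF mem(3)[OF T x]] by simp
    then show "T = vzero ?B" by (intro extensionalityI[OF mem(2)[OF T]]) (auto simp: sel)
  next
    assume "T = vzero ?B"
    then have "vnorm ?B T \<le> 0" by (intro bounded_operators_norm_least) (auto simp: sel norm_zero)
    then show "vnorm ?B T = 0" using bounded_operators_norm_nonneg[OF T] by simp
  qed
  \<comment> \<open>As for quotients, homogeneity follows from one inequality, applied to
    \<open>c\<close> and then to \<open>inverse c\<close>.\<close>
  have le: "vnorm ?B (vscale ?B c U) \<le> cmod c * vnorm ?B U" if U: "U \<in> carrier ?B" for c U
  proof (rule bounded_operators_norm_least)
    fix x assume x: "x \<in> carrier V"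
    show "vnorm V (vscale ?B c U x) \<le> cmod c * vnorm ?B U * vnorm V x"
      using up[OF U x] x by (simp add: sel norm_scale mem(3)[OF U x] mult.assoc mult_left_mono)
  qed (simp add: U bounded_operators_norm_nonneg)
  show "vnorm ?B (vscale ?B c T) = cmod c * vnorm ?B T" for c
  proof (cases "c = 0")
    case True
    then show ?thesis using le[OF T, of c] bounded_operators_norm_nonneg[OF sc[of c]] by simp
  next
    case False
    have "vscale ?B (inverse c) (vscale ?B c T) = T"
      using mem(3)[OF T] False
      by (intro extensionalityI[OF _ mem(2)[OF T]]) (auto simp: sel scale_one scale_scale)
    then have "vnorm ?B T \<le> inverse (cmod c) * vnorm ?B (vscale ?B c T)"
      using le[OF sc[of c], of "inverse c"] by (simp add: norm_inverse)
    then have "cmod c * vnorm ?B T \<le> vnorm ?B (vscale ?B c T)"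
      using False by (simp add: field_simps)
    with le[OF T, of c] show ?thesis by simp
  qed
qed

lemma bounded_operators_norm_compose:
  assumes T: "T \<in> carrier (bounded_operators V)" and U: "U \<in> carrier (bounded_operators V)"
  shows "vnorm (bounded_operators V) (compose (carrier V) T U)
    \<le> vnorm (bounded_operators V) T * vnorm (bounded_operators V) U"
proof (rule bounded_operators_norm_least)
  fix x assume x: "x \<in> carrier V"
  note n = bounded_operators_norm_nonneg
  have "vnorm V (T (U x)) \<le> vnorm (bounded_operators V) T * vnorm V (U x)"
    by (rule bounded_operators_norm_upper[OF T bounded_operators_memD(3)[OF U x]])
  also have "\<dots> \<le> vnorm (bounded_operators V) T * (vnorm (bounded_operators V) U * vnorm V x)"
    by (intro mult_left_mono bounded_operators_norm_upper[OF U x] n[OF T])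
  finally show "vnorm V (compose (carrier V) T U x)
    \<le> vnorm (bounded_operators V) T * vnorm (bounded_operators V) U * vnorm V x"
    using x by (simp add: compose_def mult.assoc)
qed (simp add: bounded_operators_norm_nonneg T U)

end

section \<open>Conjugation of an operator algebra by an isomorphism\<close>

lemma conjugation_banach_algebra_iso:
  fixes A :: "('x::complex_banach \<Rightarrow>\<^sub>L 'x) set" and V :: "('b, 'm) normed_struct_scheme"
  assumes A: "A \<subseteq> clinear_operators" "csubspace A" "closed A" "id_blinfun \<in> A"
    "\<And>a b. \<lbrakk>a \<in> A; b \<in> A\<rbrakk> \<Longrightarrow> a o\<^sub>L b \<in> A"
    and iso: "banach_space_iso V (subspace_struct UNIV) T"
  shows "banach_algebra_iso_onto_image (operator_algebra A) (bounded_operators V)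
    (\<lambda>a. \<lambda>f\<in>carrier V. inv_into (carrier V) T (blinfun_apply a (T f)))"
proof -
  let ?X = "subspace_struct (UNIV :: 'x set)" and ?M = "operator_algebra A"
    and ?B = "bounded_operators V"
  define G where "G = inv_into (carrier V) T"
  define R where "R = (\<lambda>a. \<lambda>f\<in>carrier V. G (blinfun_apply a (T f)))"
  let ?N = "?B\<lparr>carrier := R ` A\<rparr>"
  note isoD = iso[unfolded banach_space_iso_def, folded G_def]
  interpret V: banach_space_on V using isoD by blast
  interpret X: banach_space_on ?X using isoD by blast
  interpret M: banach_algebra_on ?M by (rule banach_algebra_on_operator_algebra) (use A in auto)
  interpret B: normed_space_on ?B by (rule V.normed_space_on_bounded_operators)
  have X: "carrier ?X = UNIV" "vadd ?X = (+)" "vscale ?X = scaleC" "vnorm ?X = norm"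
    by (simp_all add: subspace_struct_def)
  have M: "carrier ?M = A" "vadd ?M = (+)" "vzero ?M = 0" "vscale ?M = scaleC" "vnorm ?M = norm"
    "amult ?M = (o\<^sub>L)" "aone ?M = id_blinfun"
    by (simp_all add: operator_algebra_def)
  have Bsel: "vadd ?B = (\<lambda>S U. \<lambda>x\<in>carrier V. vadd V (S x) (U x))"
    "vzero ?B = (\<lambda>x\<in>carrier V. vzero V)" "vscale ?B = (\<lambda>c S. \<lambda>x\<in>carrier V. vscale V c (S x))"
    "amult ?B = compose (carrier V)" "aone ?B = (\<lambda>x\<in>carrier V. x)"
    by (simp_all add: bounded_operators_def)
  have Tb: "bounded_clinear_on V ?X T" and Gb: "bounded_clinear_on ?X V G" using isoD by blast+
  have Tlin: "T (vadd V f g) = T f + T g" "T (vscale V c f) = c *\<^sub>C T f"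
    if "f \<in> carrier V" "g \<in> carrier V" for f g c
    using Tb that by (auto simp: bounded_clinear_on_def X)
  have Glin: "G (u + v) = vadd V (G u) (G v)" "G (c *\<^sub>C u) = vscale V c (G u)" for u v c
    using Gb by (auto simp: bounded_clinear_on_def X)
  have Gcl: "G u \<in> carrier V" for u using Gb by (auto simp: bounded_clinear_on_def X)
  have GT: "G (T f) = f" if "f \<in> carrier V" for f
    using isoD that unfolding G_def by (meson bij_betw_inv_into_left)
  have TG: "T (G u) = u" for u
    using isoD unfolding G_def by (metis X(1) UNIV_I bij_betw_inv_into_right)
  have G0: "G 0 = vzero V"
    using Glin(2)[of 0 0] V.scale_zero[OF Gcl[of 0]] scaleR_scaleC[of 0 "0 :: 'x"] by simp
  obtain m where m0: "0 < m" "\<And>f. f \<in> carrier V \<Longrightarrow> vnorm ?X (T f) \<le> m * vnorm V f"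
    using bounded_clinear_on_bound[OF V.normed_space_on_axioms Tb] by blast
  note m = m0[unfolded X]
  obtain n where n0: "0 < n" "\<And>u. u \<in> carrier ?X \<Longrightarrow> vnorm V (G u) \<le> n * vnorm ?X u"
    using bounded_clinear_on_bound[OF X.normed_space_on_axioms Gb] by blast
  note n = n0(1) n0(2)[unfolded X, OF UNIV_I]
  have cl: "blinfun_apply a (c *\<^sub>C v) = c *\<^sub>C blinfun_apply a v" if "a \<in> A" for a c v
    using that A(1) by (auto simp: clinear_operators_def)
  have Rcl: "R a \<in> carrier ?B" if a: "a \<in> A" for a
  proof -
    have "bounded_clinear_on ?X ?X (blinfun_apply a)"
      unfolding bounded_clinear_on_def
      by (intro conjI exI[of _ "norm a"]) (simp_all add: X blinfun.add_right cl a norm_blinfun)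
    then have "bounded_clinear_on V ?X (\<lambda>f. blinfun_apply a (T f))"
      by (rule bounded_clinear_on_compose[OF V.normed_space_on_axioms Tb X.normed_space_on_axioms])
    from bounded_clinear_on_compose[OF V.normed_space_on_axioms this X.normed_space_on_axioms Gb]
    have "bounded_clinear_on V V (\<lambda>f. G (blinfun_apply a (T f)))" .
    then show ?thesis unfolding R_def by (rule V.bounded_operators_mem)
  qed
  \<comment> \<open>Conjugating back recovers \<open>a\<close> from \<open>R a\<close>; both
    injectivity and the lower norm bound rest on this.\<close>
  have Rlow: "blinfun_apply a v = T (R a (G v))" for a v
    by (simp add: R_def Gcl TG)
  have Radd: "R (a + b) = vadd ?B (R a) (R b)" for a b
    by (auto simp: R_def Bsel Glin blinfun.add_left)
  have Rscale: "R (c *\<^sub>C a) = vscale ?B c (R a)" for a c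
    by (auto simp: R_def Bsel Glin scaleC_blinfun.rep_eq)
  have Rzero: "R 0 = vzero ?B"
    by (auto simp: R_def Bsel G0)
  have Rmult: "R (a o\<^sub>L b) = compose (carrier V) (R a) (R b)" for a b
    by (auto simp: R_def compose_def Gcl TG)
  have Rone: "R id_blinfun = (\<lambda>x\<in>carrier V. x)"
    by (auto simp: R_def GT)
  \<comment> \<open>Here \<open>m\<close> bounds \<open>T\<close> and \<open>n\<close> bounds its
    inverse \<open>G\<close>. Conjugation in either direction therefore changes norms at most by the
    factor \<open>m * n\<close>.\<close>
  have Rup: "vnorm ?B (R a) \<le> (n * m) * norm a" for a
  proof (rule V.bounded_operators_norm_least)
    fix f assume f: "f \<in> carrier V"
    have "vnorm V (R a f) \<le> n * norm (blinfun_apply a (T f))"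
      using n(2) f by (simp add: R_def)
    also have "\<dots> \<le> n * (norm a * (m * vnorm V f))"
      using n(1) m(2)[OF f]
      by (intro mult_left_mono order_trans[OF norm_blinfun]) auto
    finally show "vnorm V (R a f) \<le> n * m * norm a * vnorm V f" by (simp add: mult_ac)
  qed (use n m in auto)
  have Rbd: "norm a \<le> (m * n) * vnorm ?B (R a)" if a: "a \<in> A" for a
  proof (rule norm_blinfun_bound)
    fix v
    have Rn: "0 \<le> vnorm ?B (R a)" by (rule B.norm_nonneg[OF Rcl[OF a]])
    have "norm (blinfun_apply a v) \<le> m * vnorm V (R a (G v))"
      unfolding Rlow[of a v]
      by (intro m V.bounded_operators_memD(3)[OF Rcl[OF a]] Gcl)
    also have "\<dots> \<le> m * (vnorm ?B (R a) * (n * norm v))"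
      using m(1) V.bounded_operators_norm_upper[OF Rcl[OF a] Gcl[of v]]
        mult_left_mono[OF n(2)[of v] Rn]
      by (intro mult_left_mono) auto
    finally show "norm (blinfun_apply a v) \<le> m * n * vnorm ?B (R a) * norm v"
      by (simp add: mult_ac)
  qed (use m n B.norm_nonneg[OF Rcl[OF a]] in auto)
  have N: "normed_space_on ?N"
  proof (rule B.normed_space_on_subset)
    show "R ` A \<subseteq> carrier ?B" using Rcl by auto
    show "vzero ?B \<in> R ` A"
      using A(2) by (auto simp: Rzero[symmetric] csubspace_def)
    show "vadd ?B S U \<in> R ` A" if "S \<in> R ` A" "U \<in> R ` A" for S U
      using that A(2) by (auto simp: Radd[symmetric] csubspace_def)
    show "vscale ?B c S \<in> R ` A" if "S \<in> R ` A" for S c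
      using that A(2) by (auto simp: Rscale[symmetric] csubspace_def)
  qed
  have "inj_on R A"
  proof (rule inj_onI)
    fix a b assume "R a = R b"
    then have "blinfun_apply a v = blinfun_apply b v" for v using Rlow by metis
    then show "a = b" by (rule blinfun_eqI)
  qed
  moreover have "bounded_clinear_on ?M ?N R"
    unfolding bounded_clinear_on_def using Rup
    by (auto simp: M Radd Rscale intro!: exI[of _ "n * m"])
  \<comment> \<open>Up to here \<open>?N\<close> is known to be a normed space only; its
    completeness is obtained from that of \<open>A\<close>.\<close>
  ultimately have iso': "banach_space_iso ?M ?N R"
    using M.banach_space_on_axioms Rbd
    by (intro banach_space_isoI[OF M.normed_space_on_axioms N]) (auto simp: M bij_betw_def)
  then interpret N: banach_space_on ?N by (simp add: banach_space_iso_def)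
  have "banach_algebra_on ?N"
  proof
    fix S U assume S: "S \<in> carrier ?N" and U: "U \<in> carrier ?N"
    then have SB: "S \<in> carrier ?B" and UB: "U \<in> carrier ?B" using Rcl by auto
    note mem = V.bounded_operators_memD
    show "amult ?N S U \<in> carrier ?N"
      using S U A(5) by (auto simp: Bsel Rmult[symmetric])
    show "amult ?N (aone ?N) S = S" "amult ?N S (aone ?N) = S"
      using mem(2,3)[OF SB] by (auto simp: Bsel compose_def intro!: extensionalityI[OF _ mem(2)[OF SB]])
    show "vnorm ?N (amult ?N S U) \<le> vnorm ?N S * vnorm ?N U"
      using V.bounded_operators_norm_compose[OF SB UB] by (simp add: Bsel)
    show "amult ?N (vscale ?N c S) U = vscale ?N c (amult ?N S U)" for c
      using mem(3)[OF UB] by (auto simp: Bsel compose_def)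
    show "amult ?N S (vscale ?N c U) = vscale ?N c (amult ?N S U)" for c
      using mem(3)[OF UB] mem(1)[OF SB] by (auto simp: Bsel compose_def bounded_clinear_on_def)
    fix W assume W: "W \<in> carrier ?N"
    then have WB: "W \<in> carrier ?B" using Rcl by auto
    show "amult ?N (amult ?N S U) W = amult ?N S (amult ?N U W)"
      using mem(3)[OF WB] by (auto simp: Bsel compose_def)
    show "amult ?N (vadd ?N S U) W = vadd ?N (amult ?N S W) (amult ?N U W)"
      using mem(3)[OF WB] by (auto simp: Bsel compose_def)
    show "amult ?N S (vadd ?N U W) = vadd ?N (amult ?N S U) (amult ?N S W)"
      using mem(3)[OF UB] mem(3)[OF WB] mem(1)[OF SB]
      by (auto simp: Bsel compose_def bounded_clinear_on_def)
  next
    show "aone ?N \<in> carrier ?N" using A(4) by (auto simp: Bsel Rone[symmetric])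
  qed
  then have "banach_algebra_iso ?M ?N R"
    using iso' M.banach_algebra_on_axioms
    by (simp add: banach_algebra_iso_def M Bsel Rmult Rone)
  then show ?thesis
    using Rcl by (auto simp: banach_algebra_iso_onto_image_def M R_def[symmetric] G_def[symmetric])
qed

section \<open>Absorbing convex sets\<close>

text \<open>Baire category applied to the dilates of \<open>B\<close>, followed by successive approximation.\<close>

lemma absorbing_sigma_convex_norm_bound:
  fixes B :: "'a::banach set"
  assumes conv: "convex B" and sym: "\<And>b. b \<in> B \<Longrightarrow> - b \<in> B"
    and absorb: "\<And>v. \<exists>n. v \<in> (\<lambda>b. real (Suc n) *\<^sub>R b) ` B"
    and series: "\<And>b. (\<And>n. b n \<in> B) \<Longrightarrow> \<exists>c\<in>B. (\<lambda>n. (1/2) ^ Suc n *\<^sub>R b n) sums c"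
  shows "\<exists>C>0. \<forall>v. \<exists>b\<in>B. v = (C * norm v) *\<^sub>R b"
proof -
  define G where "G = range (\<lambda>n. closure ((\<lambda>b. real (Suc n) *\<^sub>R b) ` B))"
  have "\<Union>G = UNIV"
    using absorb closure_subset by (fastforce simp: G_def)
  \<comment> \<open>By Baire, a countable union of closed sets with empty interior has empty
    interior, whereas this union is the whole space.\<close>
  have "\<not> (\<forall>T\<in>G. interior T = {})"
  proof
    assume "\<forall>T\<in>G. interior T = {}"
    then have "euclidean interior_of \<Union>G = {}"
      using completely_metrizable_space_euclidean
      by (intro Baire_category_alt) (auto simp: G_def)
    with \<open>\<Union>G = UNIV\<close> show False by simp
  qed
  then obtain n where "interior (closure ((\<lambda>b. real (Suc n) *\<^sub>R b) ` B)) \<noteq> {}"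
    unfolding G_def by blast
  then have "interior ((\<lambda>b. real (Suc n) *\<^sub>R b) ` closure B) \<noteq> {}"
    unfolding closure_scaleR .
  then obtain U where U: "open U" "U \<noteq> {}" "U \<subseteq> (\<lambda>b. real (Suc n) *\<^sub>R b) ` closure B"
    by (meson interior_subset open_interior)
  \<comment> \<open>The dilation factors are \<open>Suc n\<close> and hence invertible, so the open
    set can be scaled back into the closure of \<open>B\<close>.\<close>
  have "(\<lambda>u. inverse (real (Suc n)) *\<^sub>R u) ` U \<subseteq> interior (closure B)"
  proof (rule interior_maximal)
    show "open ((\<lambda>u. inverse (real (Suc n)) *\<^sub>R u) ` U)"
      by (rule open_scaling[OF _ U(1)]) simp
    show "(\<lambda>u. inverse (real (Suc n)) *\<^sub>R u) ` U \<subseteq> closure B"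
      using U(3) by (auto simp del: of_nat_Suc)
  qed
  with U(2) have "interior (closure B) \<noteq> {}" by blast
  then obtain y r where r: "r > 0" "ball y r \<subseteq> closure B"
    by (metis ex_in_conv mem_interior)
  have csym: "- b \<in> closure B" if "b \<in> closure B" for b
    using that sym unfolding closure_approachable by (metis dist_minus)
  \<comment> \<open>The ball is moved to the origin: \<open>z\<close> is the midpoint of
    \<open>y + z\<close> and \<open>- (y - z)\<close>, both in the closure by symmetry.\<close>
  have ball: "z \<in> closure B" if z: "norm z < r" for z
  proof -
    have "y + z \<in> closure B" "y - z \<in> closure B" using r(2) z by (auto simp: dist_norm)
    then have "(1/2) *\<^sub>R (y + z) + (1/2) *\<^sub>R (- (y - z)) \<in> closure B"
      by (intro convexD[OF convex_closure[OF conv]] csym) simp_all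
    moreover have "(1/2) *\<^sub>R (y + z) + (1/2) *\<^sub>R (- (y - z)) = z"
      by (simp add: algebra_simps scaleR_left_distrib[symmetric])
    ultimately show ?thesis by simp
  qed
  \<comment> \<open>Approximation within \<open>r / 2\<close> followed by doubling leaves the
    remainder in the ball of radius \<open>r\<close>, so the step can be repeated.\<close>
  have "\<exists>b\<in>B. norm (2 *\<^sub>R (z - b)) < r" if z: "norm z < r" for z
  proof -
    obtain b where b: "b \<in> B" "dist b z < r / 2"
      using ball[OF z] r(1) unfolding closure_approachable by (meson half_gt_zero)
    have "norm (2 *\<^sub>R (z - b)) = 2 * dist b z" by (simp add: dist_norm norm_minus_commute)
    with b show ?thesis by (intro bexI[of _ b]) simp_all
  qed
  then obtain g where g: "\<And>z. norm z < r \<Longrightarrow> g z \<in> B \<and> norm (2 *\<^sub>R (z - g z)) < r" by metis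
  have half: "\<exists>c\<in>B. z = 2 *\<^sub>R c" if z: "norm z < r" for z
  proof -
    \<comment> \<open>The error after \<open>n\<close> approximation steps is \<open>s n\<close>
      divided by \<open>2 ^ n\<close>; the magnified error \<open>s n\<close> never leaves the
      ball.\<close>
    define s where "s = rec_nat z (\<lambda>_ w. 2 *\<^sub>R (w - g w))"
    have s0: "s 0 = z" and sS: "s (Suc n) = 2 *\<^sub>R (s n - g (s n))" for n by (simp_all add: s_def)
    have sr: "norm (s n) < r" for n
    proof (induction n)
      case (Suc n)
      then show ?case unfolding sS using g by blast
    qed (simp add: s0 z)
    \<comment> \<open>The partial sums telescope. The weights start at \<open>1/2\<close> to have
      total 1, so the series converges to half of \<open>z\<close>; this is the factor 2 in the
      claim.\<close>
    have part: "(\<Sum>i<n. (1/2) ^ Suc i *\<^sub>R g (s i)) = (1/2) *\<^sub>R z - (1/2) ^ Suc n *\<^sub>R s n" for n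
      by (induction n) (simp_all add: s0 sS algebra_simps)
    obtain c where c: "c \<in> B" "(\<lambda>n. (1/2) ^ Suc n *\<^sub>R g (s n)) sums c"
      using series[of "\<lambda>n. g (s n)"] g sr by blast
    have "(\<lambda>n. (1/2) ^ Suc n *\<^sub>R s n) \<longlonglongrightarrow> 0"
    proof (rule Lim_null_comparison)
      have "norm ((1/2) ^ Suc n *\<^sub>R s n) \<le> (1/2) ^ Suc n * r" for n
        using sr[of n] by (simp add: mult_left_mono)
      then show "\<forall>\<^sub>F n in sequentially. norm ((1/2) ^ Suc n *\<^sub>R s n) \<le> (1/2) ^ Suc n * r"
        by simp
      have "(\<lambda>n. (1/2 :: real) ^ Suc n) \<longlonglongrightarrow> 0"
        using LIMSEQ_Suc[OF LIMSEQ_power_zero[of "1/2 :: real"]] by simp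
      then show "(\<lambda>n. (1/2) ^ Suc n * r) \<longlonglongrightarrow> 0"
        by (rule tendsto_mult_left_zero)
    qed
    then have "(\<lambda>n. (1/2) *\<^sub>R z - (1/2) ^ Suc n *\<^sub>R s n) \<longlonglongrightarrow> (1/2) *\<^sub>R z - 0"
      by (intro tendsto_diff tendsto_const)
    then have "(\<lambda>n. (1/2) ^ Suc n *\<^sub>R g (s n)) sums ((1/2) *\<^sub>R z)"
      unfolding sums_def part by simp
    then have "c = (1/2) *\<^sub>R z" using c(2) sums_unique2 by blast
    then show ?thesis using c(1) by (intro bexI[of _ c]) auto
  qed
  show ?thesis
  \<comment> \<open>A nonzero \<open>v\<close> is scaled to norm \<open>r / 2\<close>, inside the
    ball. Undoing this costs \<open>2 * norm v / r\<close>, and the factor 2 from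
    \<open>half\<close> makes it \<open>4 / r * norm v\<close>.\<close>
  proof (intro exI[of _ "4 / r"] conjI allI)
    fix v :: 'a
    show "\<exists>b\<in>B. v = (4 / r * norm v) *\<^sub>R b"
    proof (cases "v = 0")
      case True
      obtain c where "c \<in> B" using half[of 0] r(1) by auto
      with True show ?thesis by auto
    next
      case False
      let ?k = "r / (2 * norm v)"
      have "norm (?k *\<^sub>R v) < r" using False r(1) by simp
      then obtain c where c: "c \<in> B" "?k *\<^sub>R v = 2 *\<^sub>R c" using half by blast
      have "v = inverse ?k *\<^sub>R ?k *\<^sub>R v" using False r(1) by simp
      also have "\<dots> = (inverse ?k * 2) *\<^sub>R c" unfolding c(2) by simp
      also have "inverse ?k * 2 = 4 / r * norm v" by simp
      finally show ?thesis using c(1) by blast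
    qed
  qed (use r(1) in simp)
qed

section \<open>Split strict multiplicity\<close>

definition annihilator :: "('x::complex_banach \<Rightarrow>\<^sub>L 'x) set \<Rightarrow> 'x \<Rightarrow> ('x \<Rightarrow>\<^sub>L 'x) set"
  where "annihilator A v = {a \<in> A. blinfun_apply a v = 0}"

text \<open>The map has to be defined on sets, hence the choice of a representative. On cosets of
  the annihilator of \<open>v\<close> the value does not depend on it, see
  \<open>orbit_map_coset\<close>.\<close>

definition orbit_map :: "'x::complex_banach \<Rightarrow> ('x \<Rightarrow>\<^sub>L 'x) set \<Rightarrow> 'x"
  where "orbit_map v U = blinfun_apply (SOME a. a \<in> U) v"

locale realized_ssm =
  fixes A :: "('x::complex_banach \<Rightarrow>\<^sub>L 'x) set" and p :: nat and x :: "nat \<Rightarrow> 'x"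
  assumes algebra: "abelian_unital_closed_algebra A" and realizes: "realizes_ssm A p x"
begin

lemma
  shows clin: "A \<subseteq> clinear_operators" and csub: "csubspace A" and closed: "closed A"
    and one: "id_blinfun \<in> A" and mult: "\<lbrakk>a \<in> A; b \<in> A\<rbrakk> \<Longrightarrow> a o\<^sub>L b \<in> A"
    and commute: "\<lbrakk>a \<in> A; b \<in> A\<rbrakk> \<Longrightarrow> blinfun_apply a (blinfun_apply b v) = blinfun_apply b (blinfun_apply a v)"
proof -
  show "blinfun_apply a (blinfun_apply b v) = blinfun_apply b (blinfun_apply a v)"
    if "a \<in> A" "b \<in> A" for a b
    using algebra that by (metis abelian_unital_closed_algebra_def blinfun_apply_blinfun_compose)
qed (use algebra in \<open>auto simp: abelian_unital_closed_algebra_def\<close>)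

lemma
  shows zero_mem: "0 \<in> A" and add_mem: "\<lbrakk>a \<in> A; b \<in> A\<rbrakk> \<Longrightarrow> a + b \<in> A"
    and scaleC_mem: "a \<in> A \<Longrightarrow> c *\<^sub>C a \<in> A" and scaleR_mem: "a \<in> A \<Longrightarrow> r *\<^sub>R a \<in> A"
    and diff_mem: "\<lbrakk>a \<in> A; b \<in> A\<rbrakk> \<Longrightarrow> a - b \<in> A"
  using csub csubspace_diff[OF csub] by (auto simp: csubspace_def scaleR_scaleC)

lemma csubspace_orbit: "csubspace (orbit A v)"
proof -
  have "c *\<^sub>C blinfun_apply a v \<in> orbit A v" if "a \<in> A" for c a
    unfolding orbit_def by (rule image_eqI[OF _ scaleC_mem[OF that, of c]])
      (simp add: scaleC_blinfun.rep_eq)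
  moreover have "blinfun_apply a v + blinfun_apply b v \<in> orbit A v" if "a \<in> A" "b \<in> A" for a b
    using add_mem[OF that] by (auto simp: orbit_def blinfun.add_left[symmetric])
  moreover have "0 \<in> orbit A v"
    using zero_mem by (force simp: orbit_def)
  ultimately show ?thesis by (auto simp: csubspace_def orbit_def)
qed

lemma closed_ideal_annihilator: "closed_ideal A (annihilator A v)"
proof -
  have "annihilator A v = A \<inter> {a. blinfun_apply a v = 0}"
    by (auto simp: annihilator_def)
  moreover have "closed {a :: 'x \<Rightarrow>\<^sub>L 'x. blinfun_apply a v = 0}"
    by (intro closed_Collect_eq continuous_intros)
  ultimately have "closed (annihilator A v)" using closed by auto
  moreover have "0 *\<^sub>C (0::'x) = 0" "c *\<^sub>C (0::'x) = 0" for c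
    using norm_scaleC[of c "0::'x"] norm_scaleC[of 0 "0::'x"] by auto
  \<comment> \<open>Multiplying an annihilating operator from the left visibly preserves
    annihilation; from the right it does so because \<open>A\<close> is abelian.\<close>
  moreover have "blinfun_apply (b o\<^sub>L a) v = 0" if "a \<in> A" "b \<in> A" "blinfun_apply b v = 0" for a b
    using commute[OF that(1,2), of v] that by simp
  ultimately show ?thesis
    using zero_mem add_mem scaleC_mem mult
    by (auto simp: closed_ideal_def annihilator_def csubspace_def blinfun.add_left
        scaleC_blinfun.rep_eq)
qed

lemma csubspace_annihilator: "csubspace (annihilator A v)"
  using closed_ideal_annihilator by (simp add: closed_ideal_def)

lemma normed_space_on_quotient_annihilator: "normed_space_on (quotient_struct A (annihilator A v))"
  using closed_ideal_annihilator
  by (intro normed_space_on_quotient csub) (auto simp: closed_ideal_def)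

lemma orbit_map_coset: "orbit_map v (a +o annihilator A v) = blinfun_apply a v"
proof -
  have "a \<in> a +o annihilator A v"
    using zero_mem by (auto simp: elt_set_plus_def annihilator_def)
  then have "(SOME b. b \<in> a +o annihilator A v) \<in> a +o annihilator A v" by (rule someI)
  then show ?thesis
    by (auto simp: orbit_map_def elt_set_plus_def annihilator_def blinfun.add_left)
qed

lemma coset_annihilator_eq_iff:
  assumes "a \<in> A" "b \<in> A"
  shows "a +o annihilator A v = b +o annihilator A v \<longleftrightarrow> blinfun_apply a v = blinfun_apply b v"
  unfolding coset_eq_iff[OF csubspace_annihilator] using diff_mem[OF assms]
  by (simp add: annihilator_def blinfun.diff_left)

lemma bij_betw_orbit_map:
  "bij_betw (orbit_map v) (carrier (quotient_struct A (annihilator A v))) (orbit A v)"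
proof -
  have "inj_on (orbit_map v) ((\<lambda>a. a +o annihilator A v) ` A)"
    by (rule inj_onI) (clarsimp simp only: orbit_map_coset coset_annihilator_eq_iff)
  then show ?thesis
    by (auto simp: bij_betw_def quotient_struct_def orbit_map_coset orbit_def image_image)
qed

text \<open>Operators of \<open>A\<close> that agree at \<open>v\<close> represent the same coset,
  so a quotient norm can be bounded by the norm of any convenient one of them.\<close>

lemma norm_coset_annihilator_le:
  assumes "a \<in> A" "b \<in> A" "blinfun_apply a v = blinfun_apply b v"
  shows "vnorm (quotient_struct A (annihilator A v)) (a +o annihilator A v) \<le> norm b"
proof -
  have "b - a \<in> annihilator A v"
    using assms diff_mem by (simp add: annihilator_def blinfun.diff_left)
  from Inf_norm_coset_le[OF this, of a] show ?thesis by (simp add: quotient_struct_def)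
qed

lemma norm_orbit_map_le:
  assumes U: "U \<in> carrier (quotient_struct A (annihilator A v))"
  shows "norm (orbit_map v U) \<le> (norm v + 1) * vnorm (quotient_struct A (annihilator A v)) U"
proof -
  obtain a where a: "a \<in> A" "U = a +o annihilator A v" using U by (auto simp: quotient_struct_def)
  \<comment> \<open>Adding 1 keeps the divisor positive even for \<open>v = 0\<close>.\<close>
  have c: "norm v + 1 > 0" by (simp add: add_nonneg_pos)
  have "norm (blinfun_apply a v) / (norm v + 1) \<le> Inf (norm ` U)"
  proof (rule cInf_greatest)
    show "norm ` U \<noteq> {}" using a zero_mem by (auto simp: elt_set_plus_def annihilator_def)
    fix y assume "y \<in> norm ` U"
    then obtain i where i: "i \<in> annihilator A v" "y = norm (a + i)"
      using a by (auto simp: elt_set_plus_def)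
    have "norm (blinfun_apply a v) = norm (blinfun_apply (a + i) v)"
      using i by (simp add: annihilator_def blinfun.add_left)
    also have "\<dots> \<le> y * norm v" using i norm_blinfun by simp
    also have "\<dots> \<le> y * (norm v + 1)" using i by (intro mult_left_mono) auto
    finally show "norm (blinfun_apply a v) / (norm v + 1) \<le> y"
      using c by (simp add: pos_divide_le_eq)
  qed
  then show ?thesis
    using c a by (simp add: orbit_map_coset quotient_struct_def pos_divide_le_eq mult.commute)
qed

lemma bounded_clinear_on_orbit_map:
  "bounded_clinear_on (quotient_struct A (annihilator A v)) (subspace_struct (orbit A v)) (orbit_map v)"
  unfolding bounded_clinear_on_def
proof (intro conjI)
  let ?Q = "quotient_struct A (annihilator A v)"
  show "orbit_map v \<in> carrier ?Q \<rightarrow> carrier (subspace_struct (orbit A v))"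
    using bij_betw_orbit_map[of v] by (auto simp: bij_betw_def subspace_struct_def)
  show "\<exists>C. \<forall>U\<in>carrier ?Q. vnorm (subspace_struct (orbit A v)) (orbit_map v U) \<le> C * vnorm ?Q U"
    using norm_orbit_map_le by (auto simp: subspace_struct_def)
  show "\<forall>U\<in>carrier ?Q. \<forall>W\<in>carrier ?Q. orbit_map v (vadd ?Q U W) =
      vadd (subspace_struct (orbit A v)) (orbit_map v U) (orbit_map v W)"
    by (auto simp: quotient_struct_def subspace_struct_def coset_add csubspace_annihilator
        orbit_map_coset blinfun.add_left)
  show "\<forall>c. \<forall>U\<in>carrier ?Q. orbit_map v (vscale ?Q c U) =
      vscale (subspace_struct (orbit A v)) c (orbit_map v U)"
    by (auto simp: quotient_struct_def subspace_struct_def coset_scale csubspace_annihilator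
        orbit_map_coset scaleC_blinfun.rep_eq)
qed

section \<open>Decompositions of vectors and their norm control\<close>

lemma decomposition_unique:
  assumes a: "\<And>k. k \<in> {1..p} \<Longrightarrow> a k \<in> A" and b: "\<And>k. k \<in> {1..p} \<Longrightarrow> b k \<in> A"
    and eq: "(\<Sum>k\<in>{1..p}. blinfun_apply (a k) (x k)) = (\<Sum>k\<in>{1..p}. blinfun_apply (b k) (x k))"
    and k: "k \<in> {1..p}"
  shows "blinfun_apply (a k) (x k) = blinfun_apply (b k) (x k)"
proof -
  define v where "v = (\<Sum>k\<in>{1..p}. blinfun_apply (a k) (x k))"
  \<comment> \<open>What is unique is the family of vectors \<open>a k (x k)\<close>, not the
    operators \<open>a k\<close>. The families are restricted to \<open>{1..p}\<close> since
    uniqueness is given among extensional functions.\<close>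
  let ?u = "\<lambda>c. \<lambda>k\<in>{1..p}. blinfun_apply (c k :: 'x \<Rightarrow>\<^sub>L 'x) (x k)"
  have mem: "?u c \<in> (\<Pi>\<^sub>E k\<in>{1..p}. orbit A (x k))" if "\<And>k. k \<in> {1..p} \<Longrightarrow> c k \<in> A" for c
    using that by (auto simp: orbit_def)
  have "\<exists>\<^sub>\<le>\<^sub>1u. u \<in> (\<Pi>\<^sub>E k\<in>{1..p}. orbit A (x k)) \<and> v = (\<Sum>k\<in>{1..p}. u k)"
    using realizes unfolding realizes_ssm_def ex1_iff_ex_Uniq by blast
  moreover have "?u a \<in> (\<Pi>\<^sub>E k\<in>{1..p}. orbit A (x k)) \<and> v = (\<Sum>k\<in>{1..p}. ?u a k)"
    using mem[OF a] by (simp add: v_def)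
  moreover have "?u b \<in> (\<Pi>\<^sub>E k\<in>{1..p}. orbit A (x k)) \<and> v = (\<Sum>k\<in>{1..p}. ?u b k)"
    unfolding v_def eq using mem[OF b] by simp
  ultimately have "?u a = ?u b"
    by (rule Uniq_D[where P = "\<lambda>u. u \<in> (\<Pi>\<^sub>E k\<in>{1..p}. orbit A (x k)) \<and> v = (\<Sum>k\<in>{1..p}. u k)"])
  from fun_cong[OF this, of k] show ?thesis using k by simp
qed

lemma decomposition_exists:
  "\<exists>a. (\<forall>k\<in>{1..p}. a k \<in> A) \<and> v = (\<Sum>k\<in>{1..p}. blinfun_apply (a k) (x k))"
proof -
  obtain u where u: "u \<in> (\<Pi>\<^sub>E k\<in>{1..p}. orbit A (x k))" "v = (\<Sum>k\<in>{1..p}. u k)"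
    using realizes unfolding realizes_ssm_def by blast
  then have "\<forall>k\<in>{1..p}. \<exists>a. a \<in> A \<and> u k = blinfun_apply a (x k)" by (auto simp: orbit_def)
  then obtain a where "\<forall>k\<in>{1..p}. a k \<in> A \<and> u k = blinfun_apply (a k) (x k)" by metis
  then show ?thesis using u(2) by (intro exI[of _ a]) auto
qed

text \<open>This is the open mapping theorem for the map from \<open>p\<close>-tuples over
  \<open>A\<close> onto the space. As \<open>A\<close> is a set and not a type, it is derived from
  the image of the unit ball, whose weighted series are summed coordinatewise in
  \<open>A\<close>.\<close>

lemma decomposition_bounded:
  "\<exists>C>0. \<forall>v. \<exists>a. (\<forall>k\<in>{1..p}. a k \<in> A \<and> norm (a k) \<le> C * norm v) \<and>
    v = (\<Sum>k\<in>{1..p}. blinfun_apply (a k) (x k))"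
proof -
  let ?s = "\<lambda>a. \<Sum>k\<in>{1..p}. blinfun_apply (a k) (x k)"
  let ?P = "{a. \<forall>k\<in>{1..p}. a k \<in> A \<and> norm (a k) \<le> 1}"
  have lin: "?s (\<lambda>k. r *\<^sub>R a k) = r *\<^sub>R ?s a" for r a
    by (simp add: blinfun.scaleR_left scaleR_sum_right)
  have "\<exists>C>0. \<forall>v. \<exists>b\<in>?s ` ?P. v = (C * norm v) *\<^sub>R b"
  proof (rule absorbing_sigma_convex_norm_bound)
    show "convex (?s ` ?P)"
    proof (rule convexI)
      fix v w and r t :: real
      assume "v \<in> ?s ` ?P" "w \<in> ?s ` ?P" and rt: "0 \<le> r" "0 \<le> t" "r + t = 1"
      then obtain a b where a: "a \<in> ?P" "v = ?s a" and b: "b \<in> ?P" "w = ?s b" by blast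
      have "norm (r *\<^sub>R a k + t *\<^sub>R b k) \<le> 1" if "k \<in> {1..p}" for k
      proof -
        have "norm (r *\<^sub>R a k + t *\<^sub>R b k) \<le> r * norm (a k) + t * norm (b k)"
          using rt by (intro order_trans[OF norm_triangle_ineq]) simp
        also have "\<dots> \<le> r * 1 + t * 1"
          using rt a b that by (intro add_mono mult_left_mono) auto
        finally show ?thesis using rt by simp
      qed
      then have "(\<lambda>k. r *\<^sub>R a k + t *\<^sub>R b k) \<in> ?P"
        using a b by (auto intro!: add_mem scaleR_mem)
      moreover have "r *\<^sub>R v + t *\<^sub>R w = ?s (\<lambda>k. r *\<^sub>R a k + t *\<^sub>R b k)"
        using a b by (simp add: blinfun.add_left sum.distrib blinfun.scaleR_left scaleR_sum_right)
      ultimately show "r *\<^sub>R v + t *\<^sub>R w \<in> ?s ` ?P"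
        by (intro image_eqI[where x = "\<lambda>k. r *\<^sub>R a k + t *\<^sub>R b k"])
    qed
    show "- v \<in> ?s ` ?P" if v: "v \<in> ?s ` ?P" for v
    proof -
      obtain a where a: "a \<in> ?P" "v = ?s a" using v by blast
      have "(\<lambda>k. - a k) \<in> ?P" using a diff_mem[OF zero_mem] by auto
      moreover have "- v = ?s (\<lambda>k. - a k)" using a by (simp add: blinfun.minus_left sum_negf)
      ultimately show ?thesis by (intro image_eqI[where x = "\<lambda>k. - a k"])
    qed
    show "\<exists>n. v \<in> (\<lambda>b. real (Suc n) *\<^sub>R b) ` ?s ` ?P" for v
    proof -
      obtain a where a: "\<And>k. k \<in> {1..p} \<Longrightarrow> a k \<in> A" "v = ?s a"
        using decomposition_exists by blast
      \<comment> \<open>A bound for the sum of the norms bounds each of them, so one factor brings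
        all coefficients into the unit ball.\<close>
      obtain n where n: "(\<Sum>k\<in>{1..p}. norm (a k)) \<le> real n" using real_arch_simple by blast
      let ?b = "\<lambda>k. inverse (real (Suc n)) *\<^sub>R a k"
      have "norm (a k) \<le> real (Suc n)" if "k \<in> {1..p}" for k
        using member_le_sum[OF that, of "\<lambda>k. norm (a k)"] n by simp
      then have "?b \<in> ?P" using a by (auto simp: scaleR_mem field_simps)
      moreover have "v = real (Suc n) *\<^sub>R ?s ?b" unfolding lin a(2) by simp
      ultimately show ?thesis
        by (intro exI[of _ n] image_eqI[where x = "?s ?b"] image_eqI[where x = ?b] refl)
    qed
    fix b :: "nat \<Rightarrow> 'x" assume b: "\<And>n. b n \<in> ?s ` ?P"
    have "\<forall>n. \<exists>a. a \<in> ?P \<and> b n = ?s a"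
      using b unfolding image_iff Bex_def by (rule allI)
    from choice[OF this] obtain a where a': "\<forall>n. a n \<in> ?P \<and> b n = ?s (a n)" ..
    have a: "a n \<in> ?P" "b n = ?s (a n)" for n using spec[OF a', of n] by simp_all
    let ?f = "\<lambda>k n. (1/2) ^ Suc n *\<^sub>R a n k"
    have le: "norm (?f k n) \<le> (1/2) ^ Suc n" if "k \<in> {1..p}" for k n
      using a(1)[of n] that by (auto simp: mult_left_le)
    \<comment> \<open>The weights sum to exactly 1, so each coordinate series converges absolutely
      and its sum stays in the unit ball.\<close>
    have geo: "(\<lambda>n. (1/2 :: real) ^ Suc n) sums 1" by (rule power_half_series)
    have sm: "summable (?f k)" if "k \<in> {1..p}" for k
      by (rule summable_comparison_test'[OF sums_summable[OF geo]]) (use le that in auto)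
    define c where "c k = suminf (?f k)" for k
    have cs: "?f k sums c k" if "k \<in> {1..p}" for k
      using sm[OF that] unfolding c_def by (rule summable_sums)
    have "c k \<in> A" if k: "k \<in> {1..p}" for k
    proof (rule closed_sequentially[OF closed])
      show "(\<lambda>n. \<Sum>i<n. ?f k i) \<longlonglongrightarrow> c k" using cs[OF k] by (simp add: sums_def)
      show "(\<Sum>i<n. ?f k i) \<in> A" for n
      proof (induction n)
        case (Suc n)
        have "?f k n \<in> A" using a(1)[of n] k by (intro scaleR_mem) auto
        with Suc show ?case by (simp only: sum.lessThan_Suc add_mem)
      qed (simp add: zero_mem)
    qed
    moreover have "norm (c k) \<le> 1" if k: "k \<in> {1..p}" for k
    proof -
      have "norm (c k) \<le> (\<Sum>n. (1/2) ^ Suc n)"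
        unfolding c_def by (rule norm_suminf_le[OF le[OF k] sums_summable[OF geo]])
      then show ?thesis using sums_unique[OF geo] by simp
    qed
    ultimately have "c \<in> ?P" by auto
    \<comment> \<open>Evaluation at \<open>x k\<close> is bounded and linear in the operator, so
      convergence of the coordinates gives convergence of the finite sum.\<close>
    moreover have "(\<lambda>n. \<Sum>k\<in>{1..p}. blinfun_apply (?f k n) (x k)) sums ?s c"
      by (intro sums_sum bounded_linear.sums[OF blinfun.bounded_linear_left] cs)
    then have "(\<lambda>n. (1/2) ^ Suc n *\<^sub>R b n) sums ?s c"
      unfolding a(2) lin[symmetric] .
    ultimately show "\<exists>d\<in>?s ` ?P. (\<lambda>n. (1/2) ^ Suc n *\<^sub>R b n) sums d" by blast
  qed
  then obtain C where C: "C > 0" "\<And>v. \<exists>b\<in>?s ` ?P. v = (C * norm v) *\<^sub>R b" by blast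
  have "\<exists>a. (\<forall>k\<in>{1..p}. a k \<in> A \<and> norm (a k) \<le> C * norm v) \<and> v = ?s a" for v
  proof -
    obtain a where a: "a \<in> ?P" "v = (C * norm v) *\<^sub>R ?s a" using C(2)[of v] by blast
    have "norm ((C * norm v) *\<^sub>R a k) \<le> C * norm v" if "k \<in> {1..p}" for k
      using a that C(1) mult_left_le[of "norm (a k)" "C * norm v"] by (simp add: abs_mult)
    then show ?thesis
      using a by (intro exI[of _ "\<lambda>k. (C * norm v) *\<^sub>R a k"]) (auto simp only: lin intro: scaleR_mem)
  qed
  with C(1) show ?thesis by blast
qed

text \<open>The constant is fixed once, so that the later estimates can share it.\<close>

definition decomposition_bound :: real
  where "decomposition_bound = (SOME C. C > 0 \<and> (\<forall>v. \<exists>a. (\<forall>k\<in>{1..p}. a k \<in> A \<and> norm (a k) \<le> C * norm v) \<and>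
    v = (\<Sum>k\<in>{1..p}. blinfun_apply (a k) (x k))))"

lemma decomposition_bound:
  shows "decomposition_bound > 0"
    and "\<exists>a. (\<forall>k\<in>{1..p}. a k \<in> A \<and> norm (a k) \<le> decomposition_bound * norm v) \<and>
      v = (\<Sum>k\<in>{1..p}. blinfun_apply (a k) (x k))"
  using someI_ex[OF decomposition_bounded] unfolding decomposition_bound_def by blast+

text \<open>The same vector has a decomposition \<open>b\<close> of controlled norm. By uniqueness
  \<open>a k\<close> and \<open>b k\<close> agree at \<open>x k\<close>, so \<open>b k\<close>
  represents the coset of \<open>a k\<close>.\<close>

lemma norm_coset_le_norm_sum:
  assumes a: "\<And>k. k \<in> {1..p} \<Longrightarrow> a k \<in> A" and k: "k \<in> {1..p}"
  shows "vnorm (quotient_struct A (annihilator A (x k))) (a k +o annihilator A (x k))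
    \<le> decomposition_bound * norm (\<Sum>k\<in>{1..p}. blinfun_apply (a k) (x k))"
proof -
  obtain b where b: "\<And>k. k \<in> {1..p} \<Longrightarrow> b k \<in> A"
    "\<And>k. k \<in> {1..p} \<Longrightarrow>
      norm (b k) \<le> decomposition_bound * norm (\<Sum>k\<in>{1..p}. blinfun_apply (a k) (x k))"
    "(\<Sum>k\<in>{1..p}. blinfun_apply (a k) (x k)) = (\<Sum>k\<in>{1..p}. blinfun_apply (b k) (x k))"
    using decomposition_bound(2) by blast
  have "blinfun_apply (a k) (x k) = blinfun_apply (b k) (x k)"
    by (rule decomposition_unique[OF a b(1,3) k])
  then show ?thesis
    using norm_coset_annihilator_le[OF a[OF k] b(1)[OF k]] b(2)[OF k] by (meson order_trans)
qed

section \<open>The isomorphisms \<open>S k\<close> and their direct sum\<close>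

lemma banach_space_iso_orbit_map:
  assumes k: "k \<in> {1..p}"
  shows "banach_space_iso (quotient_struct A (annihilator A (x k))) (subspace_struct (orbit A (x k)))
    (orbit_map (x k))"
proof (rule banach_space_isoI)
  have "closed (orbit A (x k))" using realizes k by (simp add: realizes_ssm_def)
  then have B: "banach_space_on (subspace_struct (orbit A (x k)))"
    by (intro banach_space_on_csubspace) (simp_all add: subspace_struct_def csubspace_orbit)
  then show "normed_space_on (subspace_struct (orbit A (x k)))"
    by (simp add: banach_space_on_def)
  from B show "banach_space_on (quotient_struct A (annihilator A (x k))) \<or>
      banach_space_on (subspace_struct (orbit A (x k)))" ..
  show "bij_betw (orbit_map (x k)) (carrier (quotient_struct A (annihilator A (x k))))
      (carrier (subspace_struct (orbit A (x k))))"
    using bij_betw_orbit_map by (simp add: subspace_struct_def)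
  fix U assume "U \<in> carrier (quotient_struct A (annihilator A (x k)))"
  then obtain a where a: "a \<in> A" "U = a +o annihilator A (x k)"
    by (auto simp: quotient_struct_def)
  \<comment> \<open>The single vector \<open>a (x k)\<close> is the sum for the tuple with
    \<open>a\<close> in place \<open>k\<close> and zero elsewhere, which makes the general estimate
    applicable.\<close>
  have "(\<Sum>j\<in>{1..p}. blinfun_apply (if j = k then a else 0) (x j))
      = (\<Sum>j\<in>{1..p}. if j = k then blinfun_apply a (x k) else 0)"
    by (intro sum.cong) auto
  then have "(\<Sum>j\<in>{1..p}. blinfun_apply (if j = k then a else 0) (x j)) = blinfun_apply a (x k)"
    using k by simp
  then show "vnorm (quotient_struct A (annihilator A (x k))) U
      \<le> decomposition_bound * vnorm (subspace_struct (orbit A (x k))) (orbit_map (x k) U)"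
    using norm_coset_le_norm_sum[of "\<lambda>j. if j = k then a else 0" k] a k zero_mem
    by (simp add: orbit_map_coset subspace_struct_def)
qed (rule normed_space_on_quotient_annihilator bounded_clinear_on_orbit_map)+

abbreviation quotients :: "(nat \<Rightarrow> ('x \<Rightarrow>\<^sub>L 'x) set) normed_struct"
  where "quotients \<equiv> direct_sum_struct {1..p} (\<lambda>k. quotient_struct A (annihilator A (x k)))"

lemma quotients_cases:
  assumes f: "f \<in> carrier quotients"
  obtains a where "\<And>k. k \<in> {1..p} \<Longrightarrow> a k \<in> A" "f = (\<lambda>k\<in>{1..p}. a k +o annihilator A (x k))"
proof -
  have "\<forall>k\<in>{1..p}. \<exists>a. a \<in> A \<and> f k = a +o annihilator A (x k)"
    using f by (auto simp: direct_sum_struct_def quotient_struct_def)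
  then obtain a where a: "\<forall>k\<in>{1..p}. a k \<in> A \<and> f k = a k +o annihilator A (x k)" by metis
  moreover have "f \<in> extensional {1..p}" using f by (simp add: direct_sum_struct_def PiE_def)
  ultimately show thesis by (intro that[of a]) (auto intro!: extensionalityI)
qed

text \<open>Injectivity is uniqueness of decompositions, surjectivity is their existence, and the
  lower bound is \<open>norm_coset_le_norm_sum\<close> added up over \<open>k\<close>.\<close>

lemma banach_space_iso_sum_orbit_map:
  "banach_space_iso quotients (subspace_struct UNIV) (\<lambda>f. \<Sum>k\<in>{1..p}. orbit_map (x k) (f k))"
    (is "banach_space_iso _ _ ?T")
proof (rule banach_space_isoI)
  let ?I = "\<lambda>k. annihilator A (x k)"
  let ?Q = "\<lambda>k. quotient_struct A (?I k)"
  have B: "banach_space_on (subspace_struct (UNIV :: 'x set))"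
    by (intro banach_space_on_csubspace) (simp_all add: subspace_struct_def csubspace_def)
  then show "normed_space_on (subspace_struct (UNIV :: 'x set))" by (simp add: banach_space_on_def)
  from B show "banach_space_on quotients \<or> banach_space_on (subspace_struct (UNIV :: 'x set))" ..
  show "normed_space_on quotients"
    by (intro normed_space_on_direct_sum normed_space_on_quotient_annihilator) simp
  have T: "?T (\<lambda>k\<in>{1..p}. a k +o ?I k) = (\<Sum>k\<in>{1..p}. blinfun_apply (a k) (x k))" for a
    by (simp add: orbit_map_coset)
  show "bij_betw ?T (carrier quotients) (carrier (subspace_struct UNIV))"
    unfolding bij_betw_def
  proof
    show "inj_on ?T (carrier quotients)"
    proof (rule inj_onI)
      fix f g assume f: "f \<in> carrier quotients" and g: "g \<in> carrier quotients" and eq: "?T f = ?T g"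
      from f obtain a where a: "\<And>k. k \<in> {1..p} \<Longrightarrow> a k \<in> A" "f = (\<lambda>k\<in>{1..p}. a k +o ?I k)"
        by (rule quotients_cases) blast
      from g obtain b where b: "\<And>k. k \<in> {1..p} \<Longrightarrow> b k \<in> A" "g = (\<lambda>k\<in>{1..p}. b k +o ?I k)"
        by (rule quotients_cases) blast
      have "a k +o ?I k = b k +o ?I k" if "k \<in> {1..p}" for k
        using decomposition_unique[OF a(1) b(1) _ that] eq a(1)[OF that] b(1)[OF that]
        unfolding a(2) b(2) T by (simp add: coset_annihilator_eq_iff)
      then show "f = g" unfolding a(2) b(2) by (rule restrict_ext)
    qed
    have "v \<in> ?T ` carrier quotients" for v
    proof -
      obtain a where a: "\<forall>k\<in>{1..p}. a k \<in> A" "v = (\<Sum>k\<in>{1..p}. blinfun_apply (a k) (x k))"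
        using decomposition_exists by blast
      then have "(\<lambda>k\<in>{1..p}. a k +o ?I k) \<in> carrier quotients"
        by (auto simp: direct_sum_struct_def quotient_struct_def)
      then show ?thesis by (rule image_eqI[rotated]) (simp only: T a(2))
    qed
    then show "?T ` carrier quotients = carrier (subspace_struct UNIV)"
      by (auto simp: subspace_struct_def)
  qed
  note orbD = bounded_clinear_on_orbit_map[unfolded bounded_clinear_on_def]
  have fk: "f k \<in> carrier (?Q k)" if "f \<in> carrier quotients" "k \<in> {1..p}" for f k
    using that by (auto simp: direct_sum_struct_def)
  show "bounded_clinear_on quotients (subspace_struct UNIV) ?T"
    unfolding bounded_clinear_on_def
  proof (intro conjI ballI allI exI)
    fix f assume f: "f \<in> carrier quotients"
    show "?T (vadd quotients f g) = vadd (subspace_struct UNIV) (?T f) (?T g)"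
      if "g \<in> carrier quotients" for g
      using orbD fk[OF f] fk[OF that]
      by (simp add: direct_sum_struct_def subspace_struct_def sum.distrib[symmetric])
    show "?T (vscale quotients c f) = vscale (subspace_struct UNIV) c (?T f)" for c
    proof -
      have "c *\<^sub>C (\<Sum>k\<in>K. h k) = (\<Sum>k\<in>K. c *\<^sub>C h k)" for h :: "nat \<Rightarrow> 'x" and K
        using linear_sum[OF bounded_linear.linear[OF bounded_linear_scaleC]] .
      then show ?thesis
        using orbD fk[OF f] by (simp add: direct_sum_struct_def subspace_struct_def)
    qed
    \<comment> \<open>The sum of the individual constants dominates each of them and so serves all
      summands at once.\<close>
    let ?C = "\<Sum>k\<in>{1..p}. norm (x k) + 1"
    have "norm (?T f) \<le> (\<Sum>k\<in>{1..p}. ?C * vnorm (?Q k) (f k))"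
    proof (intro order_trans[OF norm_sum] sum_mono)
      fix k assume k: "k \<in> {1..p}"
      have "norm (x k) + 1 \<le> ?C" by (rule member_le_sum[OF k]) auto
      then show "norm (orbit_map (x k) (f k)) \<le> ?C * vnorm (?Q k) (f k)"
        using norm_orbit_map_le[OF fk[OF f k]]
          normed_space_on.norm_nonneg[OF normed_space_on_quotient_annihilator fk[OF f k]]
        by (meson mult_right_mono order_trans)
    qed
    then show "vnorm (subspace_struct UNIV) (?T f) \<le> ?C * vnorm quotients f"
      by (simp add: direct_sum_struct_def subspace_struct_def sum_distrib_left)
  qed (simp add: subspace_struct_def)
  fix f assume "f \<in> carrier quotients"
  then obtain a where a: "\<And>k. k \<in> {1..p} \<Longrightarrow> a k \<in> A" "f = (\<lambda>k\<in>{1..p}. a k +o ?I k)"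
    by (rule quotients_cases) blast
  \<comment> \<open>All \<open>p\<close> terms have the same bound, hence the factor
    \<open>real p\<close> in the final constant.\<close>
  have "(\<Sum>k\<in>{1..p}. vnorm (?Q k) (a k +o ?I k))
      \<le> (\<Sum>k\<in>{1..p}. decomposition_bound * norm (\<Sum>k\<in>{1..p}. blinfun_apply (a k) (x k)))"
    by (intro sum_mono norm_coset_le_norm_sum a)
  then show "vnorm quotients f
      \<le> (real p * decomposition_bound) * vnorm (subspace_struct UNIV) (?T f)"
    unfolding a(2) T by (simp add: direct_sum_struct_def subspace_struct_def mult.assoc)
qed

text \<open>Commutativity enters here: \<open>a\<close> acts on \<open>\<Sum>k. b k (x k)\<close> through the vectors \<open>a (x k)\<close>.\<close>

lemma norm_le_sum_norm_apply:
  assumes a: "a \<in> A"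
  shows "norm a \<le> decomposition_bound * (\<Sum>k\<in>{1..p}. norm (blinfun_apply a (x k)))"
proof (rule norm_blinfun_bound)
  fix v
  obtain b where b: "\<And>k. k \<in> {1..p} \<Longrightarrow> b k \<in> A"
    "\<And>k. k \<in> {1..p} \<Longrightarrow> norm (b k) \<le> decomposition_bound * norm v"
    "v = (\<Sum>k\<in>{1..p}. blinfun_apply (b k) (x k))"
    using decomposition_bound(2) by blast
  have "blinfun_apply a v = (\<Sum>k\<in>{1..p}. blinfun_apply (b k) (blinfun_apply a (x k)))"
    using b(1) by (subst b(3)) (simp add: blinfun.sum_right commute[OF a])
  also have "norm \<dots> \<le> (\<Sum>k\<in>{1..p}. decomposition_bound * norm v * norm (blinfun_apply a (x k)))"
    by (intro order_trans[OF norm_sum] sum_mono order_trans[OF norm_blinfun] mult_right_mono b(2))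
      auto
  finally show "norm (blinfun_apply a v)
      \<le> decomposition_bound * (\<Sum>k\<in>{1..p}. norm (blinfun_apply a (x k))) * norm v"
    by (simp add: sum_distrib_left[symmetric] mult_ac)
qed (use decomposition_bound(1) in \<open>simp add: sum_nonneg\<close>)

text \<open>In \<open>u n = i n + j n\<close> the part \<open>j n\<close> vanishes at
  \<open>x 2\<close> and agrees with \<open>u n\<close> at \<open>x 1\<close>. For
  \<open>p = 2\<close> these two values control its norm, so convergence of \<open>u\<close> forces
  convergence of \<open>j\<close>.\<close>

lemma closed_annihilator_sum:
  assumes p: "p = 2"
  shows "closed (annihilator A (x 1) + annihilator A (x 2))"
  unfolding closed_sequential_limits
proof (intro allI impI)
  fix u l assume H: "(\<forall>n. u n \<in> annihilator A (x 1) + annihilator A (x 2)) \<and> u \<longlonglongrightarrow> l"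
  then have l: "u \<longlonglongrightarrow> l" ..
  have "\<forall>n. \<exists>j. j \<in> annihilator A (x 2) \<and> u n - j \<in> annihilator A (x 1)"
  proof
    fix n
    from H have "u n \<in> annihilator A (x 1) + annihilator A (x 2)" by blast
    then obtain i j where "i \<in> annihilator A (x 1)" "j \<in> annihilator A (x 2)" "u n = i + j"
      by (rule set_plus_elim)
    then show "\<exists>j. j \<in> annihilator A (x 2) \<and> u n - j \<in> annihilator A (x 1)"
      by (intro exI[of _ j]) simp
  qed
  from choice[OF this] obtain j where
    j: "\<forall>n. j n \<in> annihilator A (x 2) \<and> u n - j n \<in> annihilator A (x 1)" ..
  have j2: "j n \<in> annihilator A (x 2)" and j1: "u n - j n \<in> annihilator A (x 1)" for n
    using spec[OF j, of n] by simp_all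
  \<comment> \<open>The summand 1 makes the constant positive, also when
    \<open>x 1 = 0\<close>.\<close>
  define C where "C = decomposition_bound * norm (x 1) + 1"
  have C: "C > 0" using decomposition_bound(1) by (simp add: C_def add_nonneg_pos)
  have le: "norm (j m - j n) \<le> C * norm (u m - u n)" for m n
  proof -
    have ap: "blinfun_apply (j m) (x 1) = blinfun_apply (u m) (x 1)" for m
      using j1[of m] by (simp add: annihilator_def blinfun.diff_left)
    \<comment> \<open>Of the two terms in \<open>norm_le_sum_norm_apply\<close> the one at
      \<open>x 2\<close> is zero.\<close>
    have "norm (j m - j n) \<le> decomposition_bound * norm (blinfun_apply (j m - j n) (x 1))"
      using norm_le_sum_norm_apply[of "j m - j n"] j2[of m] j2[of n]
      by (simp add: p annihilator_def diff_mem blinfun.diff_left numeral_2_eq_2)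
    also have "blinfun_apply (j m - j n) (x 1) = blinfun_apply (u m - u n) (x 1)"
      by (simp only: ap blinfun.diff_left)
    also have "decomposition_bound * norm (blinfun_apply (u m - u n) (x 1))
        \<le> decomposition_bound * (norm (u m - u n) * norm (x 1))"
      using decomposition_bound(1) by (intro mult_left_mono norm_blinfun) auto
    also have "\<dots> \<le> C * norm (u m - u n)" by (simp add: C_def algebra_simps)
    finally show ?thesis .
  qed
  have "Cauchy j"
  proof (rule CauchyI)
    fix e :: real assume "e > 0"
    then have "e / C > 0" using C by simp
    then obtain N where N: "\<And>m n. \<lbrakk>m \<ge> N; n \<ge> N\<rbrakk> \<Longrightarrow> norm (u m - u n) < e / C"
      using CauchyD[OF LIMSEQ_imp_Cauchy[OF l]] by blast
    have "norm (j m - j n) < e" if "m \<ge> N" "n \<ge> N" for m n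
    proof -
      have "C * norm (u m - u n) < e"
        using N[OF that] C by (simp add: pos_less_divide_eq mult.commute)
      with le[of m n] show ?thesis by (rule le_less_trans)
    qed
    then show "\<exists>N. \<forall>m\<ge>N. \<forall>n\<ge>N. norm (j m - j n) < e" by blast
  qed
  then obtain i where i: "j \<longlonglongrightarrow> i" using Cauchy_convergent convergent_def by blast
  have cl: "closed (annihilator A v)" for v
    using closed_ideal_annihilator by (simp add: closed_ideal_def)
  have i2: "i \<in> annihilator A (x 2)" by (rule closed_sequentially[OF cl j2 i])
  \<comment> \<open>The first components \<open>u n - j n\<close> converge to \<open>l - i\<close>,
    so closedness of both annihilators splits the limit.\<close>
  have "l - i \<in> annihilator A (x 1)"
    by (rule closed_sequentially[OF cl j1 tendsto_diff[OF l i]])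
  from set_plus_intro[OF this i2] show "l \<in> annihilator A (x 1) + annihilator A (x 2)"
    by simp
qed

end

theorem proposition1:
  fixes A :: "('x::complex_banach \<Rightarrow>\<^sub>L 'x) set"
    and p :: nat
    and x :: "nat \<Rightarrow> 'x"
  assumes "abelian_unital_closed_algebra A"
    and "realizes_ssm A p x"
  shows "\<exists>(I :: nat \<Rightarrow> ('x \<Rightarrow>\<^sub>L 'x) set) (S :: nat \<Rightarrow> ('x \<Rightarrow>\<^sub>L 'x) set \<Rightarrow> 'x).
    (let D = direct_sum_struct {1..p} (\<lambda>k. quotient_struct A (I k));
         T = (\<lambda>f. \<Sum>k\<in>{1..p}. S k (f k))
     in
      (\<forall>k\<in>{1..p}. closed_ideal A (I k)) \<and>
      (\<forall>k\<in>{1..p}. banach_space_iso (quotient_struct A (I k))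
                                   (subspace_struct (orbit A (x k))) (S k)) \<and>
      (\<forall>k\<in>{1..p}. \<forall>a\<in>A. S k (a +o I k) = blinfun_apply a (x k)) \<and>
      banach_space_iso D (subspace_struct UNIV) T \<and>
      banach_algebra_iso_onto_image (operator_algebra A) (bounded_operators D)
        (\<lambda>a. \<lambda>f\<in>carrier D. inv_into (carrier D) T (blinfun_apply a (T f))) \<and>
      (p = 2 \<longrightarrow> closed (I 1 + I 2)))"
proof -
  interpret realized_ssm A p x by unfold_locales fact+
  show ?thesis
    unfolding Let_def
    by (intro exI[of _ "\<lambda>k. annihilator A (x k)"] exI[of _ "\<lambda>k. orbit_map (x k)"] conjI ballI impI
        closed_ideal_annihilator banach_space_iso_orbit_map orbit_map_coset
        banach_space_iso_sum_orbit_map conjugation_banach_algebra_iso clin csub closed one mult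
        closed_annihilator_sum)
qed

end
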